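(* Let $k\ge0$. The ring $\mathcal R_\infty^{(k)}$ is generated by ${}_k\vartheta_r^{(0)}$ $(r\ge1)$ as an algebra over $\mathbb Z[t]$.
   Context: $x,z,t$ are infinite sequences of variables, $\mathbb Z[t]=\mathbb Z[t_1,t_2,\ldots]$. $Q_r(x)$ is defined by $\sum_{r\ge0}Q_r(x)u^r=\prod_{i\ge1}\frac{1+x_iu}{1-x_iu}$, $\Gamma=\mathbb Z[Q_1(x),Q_2(x),\ldots]$, and $\mathcal R_\infty=\Gamma[t_1,t_2,\ldots,z_1,z_2,\ldots]$. For $i\ge1$, $s_i^z$ is the ring automorphism of $\mathcal R_\infty$ exchanging $z_i,z_{i+1}$ and fixing the other $z_j$, all $t_j$ and all $Q_r(x)$; $s_0^z$ is the ring automorphism fixing all $t_j$ and all $z_j$ with $j\ge2$, with $s_0^z(z_1)=-z_1$ and $\sum_r s_0^z(Q_r(x))u^r=\frac{1+z_1u}{1-z_1u}\prod_{i\ge1}\frac{1+x_iu}{1-x_iu}$. The invariant subring is $\mathcal R_\infty^{(k)}=\{f\in\mathcal R_\infty\mid s_i^z(f)=f\ \text{for all } i\ge0,\ i\ne k\}$, a $\mathbb Z[t]$-subalgebra. The elements ${}_k\vartheta_r^{(0)}$ are defined by $\sum_{r\ge0}{}_k\vartheta_r^{(0)}u^r=\prod_{i\ge1}\frac{1+x_iu}{1-x_iu}\prod_{i=1}^k(1+z_iu)$. *)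

theory Defs
  imports
    "HOL-Library.Poly_Mapping"
    "HOL-Computational_Algebra.Formal_Power_Series"
    "HOL.Hull"
begin

abbreviation "lookup \<equiv> Poly_Mapping.lookup"
abbreviation "keys \<equiv> Poly_Mapping.keys"

section \<open>Formal power series in infinitely many variables\<close>

text \<open>Power series over the integers in variables indexed by the natural numbers. All variables
  are indexed from zero: \<open>xvar i\<close> is the variable written $x_{i+1}$ on paper, and likewise for
  the variables $z$ and $t$ below.\<close>

typedef xseries = "UNIV :: ((nat \<Rightarrow>\<^sub>0 nat) \<Rightarrow> int) set"
  morphisms coeff Abs_xseries ..

setup_lifting type_definition_xseries

lemma xseries_eqI: "(\<And>m. coeff f m = coeff g m) \<Longrightarrow> f = g"
  by (metis coeff_inject ext)

definition splits :: "(nat \<Rightarrow>\<^sub>0 nat) \<Rightarrow> ((nat \<Rightarrow>\<^sub>0 nat) \<times> (nat \<Rightarrow>\<^sub>0 nat)) set"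
  where "splits m = {(a, b). a + b = m}"

lemma finite_splits [simp]: "finite (splits m)"
proof -
  define B where "B = Max (lookup m ` keys m)"
  define F where
    "F = {f. \<forall>i. (i \<in> keys m \<longrightarrow> f i \<in> {..B}) \<and> (i \<notin> keys m \<longrightarrow> f i = 0)}"
  have B: "lookup m i \<le> B" if "i \<in> keys m" for i
    using that by (simp add: B_def)
  have "lookup a \<in> F" if "a + b = m" for a b
  proof -
    have le: "lookup a i \<le> lookup m i" for i
      using that by (auto simp: lookup_add)
    have "lookup a i \<le> B" if "i \<in> keys m" for i
      using le[of i] B[OF that] by simp
    moreover have "lookup a i = 0" if "i \<notin> keys m" for i
      using le[of i] that by (simp add: in_keys_iff)
    ultimately show ?thesis by (simp add: F_def)
  qed
  then have "(\<lambda>p. lookup (fst p)) ` splits m \<subseteq> F"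
    by (auto simp: splits_def)
  moreover have "finite F"
    unfolding F_def by (rule finite_set_of_finite_funs) simp_all
  moreover have "inj_on (\<lambda>p. lookup (fst p)) (splits m)"
  proof (rule inj_onI)
    fix p q assume pq: "p \<in> splits m" "q \<in> splits m" "lookup (fst p) = lookup (fst q)"
    then have fst: "fst p = fst q" by (simp add: poly_mapping_eqI)
    have "fst p + snd p = fst q + snd q"
      using pq(1,2) by (simp add: splits_def case_prod_unfold)
    with fst show "p = q" by (simp add: prod_eq_iff)
  qed
  ultimately show ?thesis
    using finite_imageD finite_subset by blast
qed

instantiation xseries :: comm_ring_1
begin

lift_definition zero_xseries :: xseries is "\<lambda>_. 0" .
lift_definition one_xseries :: xseries is "\<lambda>m. if m = 0 then 1 else 0" .
lift_definition plus_xseries :: "xseries \<Rightarrow> xseries \<Rightarrow> xseries" is "\<lambda>f g m. f m + g m" .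
lift_definition minus_xseries :: "xseries \<Rightarrow> xseries \<Rightarrow> xseries" is "\<lambda>f g m. f m - g m" .
lift_definition uminus_xseries :: "xseries \<Rightarrow> xseries" is "\<lambda>f m. - f m" .
lift_definition times_xseries :: "xseries \<Rightarrow> xseries \<Rightarrow> xseries"
  is "\<lambda>f g m. \<Sum>(a, b)\<in>splits m. f a * g b" .

instance
proof
  fix f g h :: xseries
  show "f + g + h = f + (g + h)" by transfer (simp add: add.assoc)
  show "f + g = g + f" by transfer (simp add: add.commute)
  show "0 + f = f" by transfer simp
  show "- f + f = 0" by transfer simp
  show "f - g = f + - g" by transfer simp
  show "(0 :: xseries) \<noteq> 1" by transfer (auto dest: fun_cong[of _ _ 0])
  show "(f + g) * h = f * h + g * h"
    by transfer (simp add: distrib_right sum.distrib case_prod_unfold)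
  show "f * g = g * f"
  proof (transfer, rule ext)
    fix f g :: "(nat \<Rightarrow>\<^sub>0 nat) \<Rightarrow> int" and m
    show "(\<Sum>(a, b)\<in>splits m. f a * g b) = (\<Sum>(a, b)\<in>splits m. g a * f b)"
      by (rule sum.reindex_bij_witness[of _ prod.swap prod.swap])
         (auto simp: splits_def add.commute mult.commute)
  qed
  show "1 * f = f"
  proof (transfer, rule ext)
    fix f :: "(nat \<Rightarrow>\<^sub>0 nat) \<Rightarrow> int" and m
    have "(\<Sum>(a, b)\<in>splits m. (if a = 0 then 1 else 0) * f b)
        = (\<Sum>(a, b)\<in>{(0 :: nat \<Rightarrow>\<^sub>0 nat, m)}. (if a = 0 then 1 else 0) * f b)"
      by (intro sum.mono_neutral_right finite_splits) (auto simp: splits_def split: if_splits)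
    then show "(\<Sum>(a, b)\<in>splits m. (if a = 0 then 1 else 0) * f b) = f m" by simp
  qed
  show "f * g * h = f * (g * h)"
  proof (transfer, rule ext)
    fix f g h :: "(nat \<Rightarrow>\<^sub>0 nat) \<Rightarrow> int" and m
    have "(\<Sum>(a, b)\<in>splits m. (\<Sum>(c, d)\<in>splits a. f c * g d) * h b)
        = (\<Sum>(p, q)\<in>Sigma (splits m) (\<lambda>p. splits (fst p)). f (fst q) * g (snd q) * h (snd p))"
      by (simp add: sum_distrib_right case_prod_unfold sum.Sigma)
    also have "\<dots> = (\<Sum>(p, q)\<in>Sigma (splits m) (\<lambda>p. splits (snd p)). f (fst p) * (g (fst q) * h (snd q)))"
      by (rule sum.reindex_bij_witness
            [of _ "\<lambda>(p, q). ((fst p + fst q, snd q), (fst p, fst q))"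
                  "\<lambda>(p, q). ((fst q, snd q + snd p), (snd q, snd p))"])
         (auto simp: splits_def add.assoc mult.assoc)
    also have "\<dots> = (\<Sum>(a, b)\<in>splits m. f a * (\<Sum>(c, d)\<in>splits b. g c * h d))"
      by (simp add: sum_distrib_left case_prod_unfold sum.Sigma)
    finally show "(\<Sum>(a, b)\<in>splits m. (\<Sum>(c, d)\<in>splits a. f c * g d) * h b)
        = (\<Sum>(a, b)\<in>splits m. f a * (\<Sum>(c, d)\<in>splits b. g c * h d))" .
  qed
qed

end

lift_definition xvar :: "nat \<Rightarrow> xseries"
  is "\<lambda>i m. if m = Poly_Mapping.single i 1 then 1 else 0" .

section \<open>The functions $Q_r(x)$\<close>

definition geometric :: "'a::comm_ring_1 \<Rightarrow> 'a fps"
  where "geometric a = Abs_fps (\<lambda>n. a ^ n)"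

lemma geometric_inverse: "(1 - fps_const a * fps_X) * geometric a = 1"
proof (rule fps_ext)
  fix n
  show "fps_nth ((1 - fps_const a * fps_X) * geometric a) n = fps_nth 1 n"
    by (cases n) (simp_all add: geometric_def algebra_simps)
qed

text \<open>The series $(1+au)/(1-au)$.\<close>

definition cayley :: "'a::comm_ring_1 \<Rightarrow> 'a fps"
  where "cayley a = (1 + fps_const a * fps_X) * geometric a"

lemma cayley_nth: "fps_nth (cayley a) n = (if n = 0 then 1 else 2 * a ^ n)"
  by (cases n) (simp_all add: cayley_def geometric_def algebra_simps)

lemma cayley_uminus: "cayley a * cayley (- a) = 1"
proof -
  have "cayley a * cayley (- a) =
      ((1 - fps_const a * fps_X) * geometric a) * ((1 - fps_const (- a) * fps_X) * geometric (- a))"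
    unfolding cayley_def by (simp add: algebra_simps flip: fps_const_neg)
  then show ?thesis by (simp only: geometric_inverse mult_1)
qed

text \<open>The infinite product $\prod_i (1+x_iu)/(1-x_iu)$ is the coefficientwise limit of its partial
  products (the integers being discrete). By the lemma \<open>coeff_partialQ\<close> below,
  each coefficient of the partial products is eventually constant.\<close>

definition partialQ :: "nat \<Rightarrow> nat \<Rightarrow> xseries"
  where "partialQ r n = fps_nth (\<Prod>i<n. cayley (xvar i)) r"

definition Qx :: "nat \<Rightarrow> xseries"
  where "Qx r = Abs_xseries (\<lambda>m. lim (\<lambda>n. coeff (partialQ r n) m))"

definition tdeg :: "('v \<Rightarrow>\<^sub>0 nat) \<Rightarrow> nat"
  where "tdeg m = (\<Sum>i\<in>keys m. lookup m i)"

lemma tdeg_add: "tdeg (a + b) = tdeg a + tdeg b"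
  unfolding tdeg_def by (rule setsum_keys_plus_distrib) simp_all

lemma tdeg_single [simp]: "tdeg (Poly_Mapping.single i j) = j"
  by (simp add: tdeg_def)

lemma tdeg_0 [simp]: "tdeg 0 = 0"
  by (simp add: tdeg_def)

lemma tdeg_eq_0_iff [simp]: "tdeg m = 0 \<longleftrightarrow> m = 0"
proof
  assume "tdeg m = 0"
  then have "\<forall>i\<in>keys m. lookup m i = 0" by (simp add: tdeg_def)
  then have "keys m = {}" by (meson all_not_in_conv in_keys_iff)
  then show "m = 0" by simp
qed simp

lemma coeff_times_monomial:
  assumes "\<And>m. coeff g m = (if m = c then 1 else 0)"
  shows "coeff (f * g) m = (if \<exists>a. m = a + c then coeff f (m - c) else 0)"
proof (cases "\<exists>a. m = a + c")
  case True
  then obtain a where a: "m = a + c" by blast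
  have "coeff (f * g) m = (\<Sum>(p, q)\<in>splits m. coeff f p * coeff g q)"
    by (simp add: times_xseries.rep_eq)
  also have "\<dots> = (\<Sum>(p, q)\<in>{(a, c)}. coeff f p * coeff g q)"
    by (intro sum.mono_neutral_right finite_splits) (auto simp: splits_def assms a split: if_splits)
  finally show ?thesis using a by (auto simp: assms)
next
  case False
  then show ?thesis
    by (auto simp: times_xseries.rep_eq splits_def assms intro!: sum.neutral)
qed

lemma coeff_xvar_power: "coeff (xvar i ^ j) m = (if m = Poly_Mapping.single i j then 1 else 0)"
proof (induction j arbitrary: m)
  case 0
  then show ?case by (simp add: one_xseries.rep_eq)
next
  case (Suc j)
  have "(\<exists>a. m = a + Poly_Mapping.single i j) \<and> m - Poly_Mapping.single i j = Poly_Mapping.single i 1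
     \<longleftrightarrow> m = Poly_Mapping.single i (Suc j)"
  proof safe
    fix a assume "a + Poly_Mapping.single i j - Poly_Mapping.single i j = Poly_Mapping.single i 1"
    then show "a + Poly_Mapping.single i j = Poly_Mapping.single i (Suc j)"
      by (simp flip: single_add)
  next
    show "\<exists>a. Poly_Mapping.single i (Suc j) = a + Poly_Mapping.single i j"
      by (rule exI[of _ "Poly_Mapping.single i 1"]) (simp flip: single_add)
    show "Poly_Mapping.single i (Suc j) - Poly_Mapping.single i j = Poly_Mapping.single i 1"
      by (simp flip: single_diff)
  qed
  then show ?case
    unfolding power_Suc coeff_times_monomial[OF Suc]
    by (auto simp: xvar.rep_eq)
qed

lemma coeff_times_xvar_power:
  "coeff (f * xvar i ^ j) m =
     (if j \<le> lookup m i then coeff f (m - Poly_Mapping.single i j) else 0)"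
proof -
  have "(\<exists>a. m = a + Poly_Mapping.single i j) \<longleftrightarrow> j \<le> lookup m i"
  proof
    assume "j \<le> lookup m i"
    then have "m = (m - Poly_Mapping.single i j) + Poly_Mapping.single i j"
      by (intro poly_mapping_eqI) (auto simp: lookup_add lookup_minus lookup_single when_def)
    then show "\<exists>a. m = a + Poly_Mapping.single i j" ..
  qed (auto simp: lookup_add)
  then show ?thesis by (simp add: coeff_times_monomial[OF coeff_xvar_power])
qed

lemma coeff_sum: "coeff (\<Sum>i\<in>A. f i) m = (\<Sum>i\<in>A. coeff (f i) m)"
  by (induction A rule: infinite_finite_induct) (simp_all add: zero_xseries.rep_eq plus_xseries.rep_eq)

lemma coeff_two_times: "coeff (2 * f) m = 2 * coeff f m"
  unfolding mult_2 plus_xseries.rep_eq by (rule refl)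

lemma coeff_partialQ:
  "coeff (partialQ r n) m = (if tdeg m = r \<and> keys m \<subseteq> {..<n} then 2 ^ card (keys m) else 0)"
proof (induction n arbitrary: r m)
  case 0
  then show ?case
    by (auto simp: partialQ_def fps_one_nth one_xseries.rep_eq zero_xseries.rep_eq)
next
  case (Suc n)
  define k where "k = lookup m n"
  define m' where "m' = m - Poly_Mapping.single n k"
  define c :: "nat \<Rightarrow> int" where "c j = (if j = 0 then 1 else 2)" for j
  have m: "m = m' + Poly_Mapping.single n k"
    by (intro poly_mapping_eqI) (auto simp: m'_def k_def lookup_add lookup_minus lookup_single when_def)
  have keys': "keys m' = keys m - {n}"
    by (auto simp: m'_def k_def in_keys_iff lookup_minus lookup_single when_def split: if_splits)
  have td: "tdeg m = tdeg m' + k" by (subst m) (simp add: tdeg_add)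
  have step: "coeff (partialQ (r - j) n * fps_nth (cayley (xvar n)) j) m =
      (if j = k then c j * coeff (partialQ (r - j) n) m' else 0)" for j
  proof -
    have "coeff (partialQ (r - j) n * fps_nth (cayley (xvar n)) j) m
        = c j * coeff (partialQ (r - j) n * xvar n ^ j) m"
      by (simp add: cayley_nth c_def coeff_two_times mult.left_commute)
    also have "\<dots> = (if j = k then c j * coeff (partialQ (r - j) n) m' else 0)"
    proof (cases "j < k")
      case True
      then have "n \<in> keys (m - Poly_Mapping.single n j)"
        by (simp add: in_keys_iff lookup_minus k_def)
      then show ?thesis using True by (auto simp: coeff_times_xvar_power Suc.IH)
    qed (auto simp: coeff_times_xvar_power m'_def k_def)
    finally show ?thesis .
  qed
  have "coeff (partialQ r (Suc n)) m
      = (\<Sum>j=0..r. coeff (partialQ (r - j) n * fps_nth (cayley (xvar n)) j) m)"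
    unfolding partialQ_def
    by (simp add: mult.commute[of _ "cayley (xvar n)"] fps_mult_nth coeff_sum mult.commute)
  also have "\<dots> = (if k \<le> r then c k * coeff (partialQ (r - k) n) m' else 0)"
    by (simp add: step)
  also have "\<dots> = (if tdeg m = r \<and> keys m \<subseteq> {..<Suc n} then 2 ^ card (keys m) else 0)"
  proof -
    have 1: "keys m' \<subseteq> {..<n} \<longleftrightarrow> keys m \<subseteq> {..<Suc n}"
      using keys' by (auto simp: less_Suc_eq)
    have 2: "c k * 2 ^ card (keys m') = 2 ^ card (keys m)"
    proof (cases "k = 0")
      case True
      then show ?thesis using m by (simp add: c_def)
    next
      case False
      then have "n \<in> keys m" by (simp add: k_def in_keys_iff)
      then have "card (keys m) = Suc (card (keys m'))"
        using card_Suc_Diff1[of "keys m" n] by (simp add: keys')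
      then show ?thesis using False by (simp add: c_def)
    qed
    show ?thesis using 1 2 td by (auto simp: Suc.IH)
  qed
  finally show ?case .
qed

lemma coeff_Qx: "coeff (Qx r) m = (if tdeg m = r then 2 ^ card (keys m) else 0)"
proof -
  obtain N where N: "keys m \<subseteq> {..<N}"
    using finite_nat_set_iff_bounded[of "keys m"] by auto
  then have "coeff (partialQ r n) m = (if tdeg m = r then 2 ^ card (keys m) else 0)" if "n \<ge> N" for n
    using that by (auto simp: coeff_partialQ subset_eq dest: less_le_trans)
  then have "\<forall>\<^sub>F n in sequentially. coeff (partialQ r n) m = (if tdeg m = r then 2 ^ card (keys m) else 0)"
    unfolding eventually_sequentially by blast
  then have "lim (\<lambda>n. coeff (partialQ r n) m) = (if tdeg m = r then 2 ^ card (keys m) else 0)"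
    by (intro limI tendsto_eventually)
  then show ?thesis by (simp add: Qx_def Abs_xseries_inverse)
qed

lemma Qx_0: "Qx 0 = 1"
  by (rule xseries_eqI) (simp add: coeff_Qx one_xseries.rep_eq)

section \<open>The rings $\Gamma$ and $\mathcal R_\infty$\<close>

definition is_subring :: "'a::comm_ring_1 set \<Rightarrow> bool"
  where "is_subring A \<longleftrightarrow> 1 \<in> A \<and> (\<forall>a\<in>A. \<forall>b\<in>A. a + b \<in> A \<and> - a \<in> A \<and> a * b \<in> A)"

lemma is_subring_hull: "is_subring (is_subring hull A)"
  by (rule hull_in) (auto simp: is_subring_def)

lemma is_subringD:
  assumes "is_subring A"
  shows "1 \<in> A" "0 \<in> A"
    and "a \<in> A \<Longrightarrow> b \<in> A \<Longrightarrow> a + b \<in> A" "a \<in> A \<Longrightarrow> - a \<in> A"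
    and "a \<in> A \<Longrightarrow> b \<in> A \<Longrightarrow> a - b \<in> A" "a \<in> A \<Longrightarrow> b \<in> A \<Longrightarrow> a * b \<in> A"
proof -
  show 1: "1 \<in> A" "a \<in> A \<Longrightarrow> b \<in> A \<Longrightarrow> a + b \<in> A" "a \<in> A \<Longrightarrow> - a \<in> A"
    "a \<in> A \<Longrightarrow> b \<in> A \<Longrightarrow> a * b \<in> A" for a b
    using assms by (auto simp: is_subring_def)
  show "0 \<in> A" using 1(2)[OF 1(1) 1(3)[OF 1(1)]] by simp
  show "a - b \<in> A" if "a \<in> A" "b \<in> A"
    using 1(2)[OF that(1) 1(3)[OF that(2)]] by simp
qed

typedef gamma = "is_subring hull (Qx ` {1..})"
  morphisms series Abs_gamma
  using is_subring_hull by (auto simp: is_subring_def)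

setup_lifting type_definition_gamma

instantiation gamma :: comm_ring_1
begin

lift_definition zero_gamma :: gamma is 0
  by (rule is_subringD[OF is_subring_hull])
lift_definition one_gamma :: gamma is 1
  by (rule is_subringD[OF is_subring_hull])
lift_definition plus_gamma :: "gamma \<Rightarrow> gamma \<Rightarrow> gamma" is "(+)"
  by (rule is_subringD[OF is_subring_hull])
lift_definition uminus_gamma :: "gamma \<Rightarrow> gamma" is "uminus"
  by (rule is_subringD[OF is_subring_hull])
lift_definition minus_gamma :: "gamma \<Rightarrow> gamma \<Rightarrow> gamma" is "(-)"
  by (rule is_subringD[OF is_subring_hull])
lift_definition times_gamma :: "gamma \<Rightarrow> gamma \<Rightarrow> gamma" is "(*)"
  by (rule is_subringD[OF is_subring_hull])

instance
  by (standard; transfer) (simp_all add: algebra_simps)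

end

lift_definition Qgamma :: "nat \<Rightarrow> gamma" is Qx
proof -
  fix r
  show "Qx r \<in> is_subring hull (Qx ` {1..})"
  proof (cases "r = 0")
    case True
    then show ?thesis using is_subring_hull[of "Qx ` {1..}"] by (simp add: Qx_0 is_subring_def)
  qed (auto intro: hull_inc)
qed

datatype var = T nat | Z nat

text \<open>Polynomials over $\Gamma$ in the variables \<open>T i\<close>, \<open>Z i\<close>: finitely supported maps from
  monomials to $\Gamma$.\<close>

type_synonym Rinf = "(var \<Rightarrow>\<^sub>0 nat) \<Rightarrow>\<^sub>0 gamma"

definition const :: "gamma \<Rightarrow> Rinf"
  where "const c = Poly_Mapping.single 0 c"

definition tvar :: "nat \<Rightarrow> Rinf"
  where "tvar i = Poly_Mapping.single (Poly_Mapping.single (T i) 1) 1"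

definition zvar :: "nat \<Rightarrow> Rinf"
  where "zvar i = Poly_Mapping.single (Poly_Mapping.single (Z i) 1) 1"

definition Q :: "nat \<Rightarrow> Rinf"
  where "Q r = const (Qgamma r)"

definition Qgf :: "Rinf fps"
  where "Qgf = Abs_fps Q"

section \<open>The automorphisms $s_i^z$\<close>

definition ring_hom :: "('a::comm_ring_1 \<Rightarrow> 'b::comm_ring_1) \<Rightarrow> bool"
  where "ring_hom \<phi> \<longleftrightarrow>
    \<phi> 1 = 1 \<and> (\<forall>a b. \<phi> (a + b) = \<phi> a + \<phi> b) \<and> (\<forall>a b. \<phi> (a * b) = \<phi> a * \<phi> b)"

definition ring_automorphism :: "('a::comm_ring_1 \<Rightarrow> 'a) \<Rightarrow> bool"
  where "ring_automorphism \<phi> \<longleftrightarrow> ring_hom \<phi> \<and> bij \<phi>"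

text \<open>Since \<open>zvar i\<close> is $z_{i+1}$, the automorphism $s_i^z$ with $i \ge 1$ exchanges
  \<open>zvar (i - 1)\<close> and \<open>zvar i\<close>, and $s_0^z$ negates \<open>zvar 0\<close>.\<close>

definition is_sz :: "nat \<Rightarrow> (Rinf \<Rightarrow> Rinf) \<Rightarrow> bool"
  where "is_sz i \<phi> \<longleftrightarrow> ring_automorphism \<phi> \<and> (\<forall>j. \<phi> (tvar j) = tvar j) \<and>
    (if i = 0
     then \<phi> (zvar 0) = - zvar 0 \<and> (\<forall>j\<ge>1. \<phi> (zvar j) = zvar j) \<and>
       Abs_fps (\<lambda>r. \<phi> (Q r)) = cayley (zvar 0) * Qgf
     else \<phi> (zvar (i - 1)) = zvar i \<and> \<phi> (zvar i) = zvar (i - 1) \<and>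
       (\<forall>j. j \<noteq> i - 1 \<and> j \<noteq> i \<longrightarrow> \<phi> (zvar j) = zvar j) \<and> (\<forall>r. \<phi> (Q r) = Q r))"

text \<open>Existence and uniqueness are the lemma \<open>ex1_is_sz\<close> at the end of this theory.\<close>

definition sz :: "nat \<Rightarrow> Rinf \<Rightarrow> Rinf"
  where "sz i = (THE \<phi>. is_sz i \<phi>)"

section \<open>Invariants and theta polynomials\<close>

definition Rinv :: "nat \<Rightarrow> Rinf set"
  where "Rinv k = {f. \<forall>i. i \<noteq> k \<longrightarrow> sz i f = f}"

definition theta :: "nat \<Rightarrow> nat \<Rightarrow> Rinf"
  where "theta k r = fps_nth (Qgf * (\<Prod>i<k. 1 + fps_const (zvar i) * fps_X)) r"

definition Zt :: "Rinf set"
  where "Zt = is_subring hull (range tvar)"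

definition is_Zt_subalgebra :: "Rinf set \<Rightarrow> bool"
  where "is_Zt_subalgebra A \<longleftrightarrow> is_subring A \<and> (\<forall>c\<in>Zt. \<forall>a\<in>A. c * a \<in> A)"

section \<open>Existence and uniqueness of the automorphisms $s_i^z$\<close>

lemma ring_homD:
  assumes "ring_hom \<phi>"
  shows ring_hom_1: "\<phi> 1 = 1" and ring_hom_add: "\<phi> (a + b) = \<phi> a + \<phi> b"
    and ring_hom_mult: "\<phi> (a * b) = \<phi> a * \<phi> b"
    and ring_hom_0: "\<phi> 0 = 0" and ring_hom_uminus: "\<phi> (- a) = - \<phi> a"
proof -
  show 1: "\<phi> 1 = 1" "\<phi> (a + b) = \<phi> a + \<phi> b" "\<phi> (a * b) = \<phi> a * \<phi> b" for a b
    using assms by (auto simp: ring_hom_def)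
  show 0: "\<phi> 0 = 0" using 1(2)[of 0 0] by simp
  show "\<phi> (- a) = - \<phi> a" using 1(2)[of a "- a"] 0 by (simp add: eq_neg_iff_add_eq_0 add.commute)
qed

lemma ring_hom_2: "ring_hom \<phi> \<Longrightarrow> \<phi> 2 = 2"
  unfolding one_add_one[symmetric] by (simp only: ring_hom_add ring_hom_1)

lemma ring_hom_sum: "ring_hom \<phi> \<Longrightarrow> \<phi> (\<Sum>i\<in>A. f i) = (\<Sum>i\<in>A. \<phi> (f i))"
  by (induction A rule: infinite_finite_induct) (simp_all add: ring_homD)

lemma ring_hom_prod: "ring_hom \<phi> \<Longrightarrow> \<phi> (\<Prod>i\<in>A. f i) = (\<Prod>i\<in>A. \<phi> (f i))"
  by (induction A rule: infinite_finite_induct) (simp_all add: ring_homD)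

lemma ring_hom_power: "ring_hom \<phi> \<Longrightarrow> \<phi> (a ^ n) = \<phi> a ^ n"
  by (induction n) (simp_all add: ring_homD)

lemma poly_mapping_sum_single: "p = (\<Sum>m\<in>keys p. Poly_Mapping.single m (lookup p m))"
  by (rule poly_mapping_eqI)
     (simp add: lookup_sum lookup_single when_def in_keys_iff sum.delta' split: if_splits)

definition eval_hom :: "('b \<Rightarrow> 'c) \<Rightarrow> ('k \<Rightarrow> 'c) \<Rightarrow> ('k \<Rightarrow>\<^sub>0 'b::comm_ring_1) \<Rightarrow> 'c::comm_ring_1"
  where "eval_hom h e p = (\<Sum>m\<in>keys p. h (lookup p m) * e m)"

lemma eval_hom_single: "ring_hom h \<Longrightarrow> eval_hom h e (Poly_Mapping.single m c) = h c * e m"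
  by (cases "c = 0") (simp_all add: eval_hom_def ring_homD)

lemma eval_hom_add: "ring_hom h \<Longrightarrow> eval_hom h e (p + q) = eval_hom h e p + eval_hom h e q"
  unfolding eval_hom_def
  by (rule setsum_keys_plus_distrib) (simp_all add: ring_homD distrib_right)

lemma eval_hom_sum: "ring_hom h \<Longrightarrow> eval_hom h e (\<Sum>i\<in>A. f i) = (\<Sum>i\<in>A. eval_hom h e (f i))"
  by (induction A rule: infinite_finite_induct) (simp_all add: eval_hom_add, simp_all add: eval_hom_def)

lemma ring_hom_eval_hom:
  fixes e :: "'k::comm_monoid_add \<Rightarrow> 'c::comm_ring_1"
  assumes h: "ring_hom h" and e: "e 0 = 1" "\<And>a b. e (a + b) = e a * e b"
  shows "ring_hom (eval_hom h e)"
  unfolding ring_hom_def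
proof (intro conjI allI)
  show "eval_hom h e 1 = 1"
    using eval_hom_single[OF h, of e 0 1] by (simp add: e ring_homD[OF h])
  show "eval_hom h e (p + q) = eval_hom h e p + eval_hom h e q" for p q
    by (rule eval_hom_add[OF h])
  show "eval_hom h e (p * q) = eval_hom h e p * eval_hom h e q" for p q
  proof -
    have "p * q = (\<Sum>m\<in>keys p. \<Sum>n\<in>keys q. Poly_Mapping.single (m + n) (lookup p m * lookup q n))"
      by (subst poly_mapping_sum_single[of p], subst poly_mapping_sum_single[of q])
         (simp add: sum_product mult_single)
    then have "eval_hom h e (p * q) =
        (\<Sum>m\<in>keys p. \<Sum>n\<in>keys q. h (lookup p m * lookup q n) * e (m + n))"
      by (simp add: eval_hom_sum[OF h] eval_hom_single[OF h])
    also have "\<dots> = eval_hom h e p * eval_hom h e q"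
      by (simp add: eval_hom_def sum_product e ring_homD[OF h] mult_ac)
    finally show ?thesis .
  qed
qed

definition eval_var :: "(var \<Rightarrow> Rinf) \<Rightarrow> (var \<Rightarrow>\<^sub>0 nat) \<Rightarrow> Rinf"
  where "eval_var \<sigma> m = (\<Prod>v\<in>keys m. \<sigma> v ^ lookup m v)"

lemma eval_var_single [simp]: "eval_var \<sigma> (Poly_Mapping.single v n) = \<sigma> v ^ n"
  by (simp add: eval_var_def)

lemma eval_var_0 [simp]: "eval_var \<sigma> 0 = 1"
  by (simp add: eval_var_def)

lemma eval_var_superset:
  "finite A \<Longrightarrow> keys m \<subseteq> A \<Longrightarrow> eval_var \<sigma> m = (\<Prod>v\<in>A. \<sigma> v ^ lookup m v)"
  unfolding eval_var_def by (rule prod.mono_neutral_left) (auto simp: in_keys_iff)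

lemma eval_var_add: "eval_var \<sigma> (a + b) = eval_var \<sigma> a * eval_var \<sigma> b"
  using keys_add[of a b]
  by (simp add: eval_var_superset[of "keys a \<union> keys b"] lookup_add power_add prod.distrib)

lemma ring_hom_const: "ring_hom const"
  by (simp add: ring_hom_def const_def single_add mult_single)

definition subst_hom :: "(gamma \<Rightarrow> Rinf) \<Rightarrow> (var \<Rightarrow> Rinf) \<Rightarrow> Rinf \<Rightarrow> Rinf"
  where "subst_hom h \<sigma> = eval_hom h (eval_var \<sigma>)"

lemma
  assumes h: "ring_hom h"
  shows ring_hom_subst_hom: "ring_hom (subst_hom h \<sigma>)"
    and subst_hom_const: "subst_hom h \<sigma> (const c) = h c"
    and subst_hom_tvar: "subst_hom h \<sigma> (tvar i) = \<sigma> (T i)"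
    and subst_hom_zvar: "subst_hom h \<sigma> (zvar i) = \<sigma> (Z i)"
  unfolding subst_hom_def const_def tvar_def zvar_def
  by (simp_all add: ring_hom_eval_hom[OF h] eval_var_add eval_hom_single[OF h] ring_homD[OF h])

lemma single_eq_eval_var:
  "Poly_Mapping.single m c = const c * eval_var (case_var tvar zvar) m"
proof -
  have pow: "Poly_Mapping.single (Poly_Mapping.single v 1) (1::gamma) ^ n
      = Poly_Mapping.single (Poly_Mapping.single v n) 1" for v :: var and n
    by (induction n) (simp_all add: mult_single flip: single_add)
  have pr: "(\<Prod>v\<in>A. Poly_Mapping.single (f v) (1::gamma)) = Poly_Mapping.single (\<Sum>v\<in>A. f v) 1"
    if "finite A" for A and f :: "var \<Rightarrow> var \<Rightarrow>\<^sub>0 nat"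
    using that by induction (simp_all add: mult_single)
  have "case_var tvar zvar v = Poly_Mapping.single (Poly_Mapping.single v 1) 1" for v
    by (cases v) (simp_all add: tvar_def zvar_def)
  then have "eval_var (case_var tvar zvar) m = Poly_Mapping.single m 1"
    unfolding eval_var_def
    by (simp only: pow pr[OF finite_keys] flip: poly_mapping_sum_single)
  then show ?thesis by (simp add: const_def mult_single)
qed

lemma gamma_induct [case_names one Q add uminus mult]:
  assumes "P 1" "\<And>r. r \<ge> 1 \<Longrightarrow> P (Qgamma r)" "\<And>a b. P a \<Longrightarrow> P b \<Longrightarrow> P (a + b)"
    "\<And>a. P a \<Longrightarrow> P (- a)" "\<And>a b. P a \<Longrightarrow> P b \<Longrightarrow> P (a * b)"
  shows "P g"
proof -
  let ?A = "series ` {g. P g}"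
  have "series g \<in> is_subring hull (Qx ` {1..})" by (rule series)
  then have "series g \<in> ?A"
  proof (rule hull_induct)
    show "x \<in> ?A" if x: "x \<in> Qx ` {1..}" for x
    proof -
      from x obtain r where "r \<ge> 1" "x = series (Qgamma r)" by (auto simp: Qgamma.rep_eq)
      then show ?thesis using assms(2) by blast
    qed
    show "is_subring {x. x \<in> ?A}"
      unfolding is_subring_def
      using assms
      by (auto simp flip: one_gamma.rep_eq plus_gamma.rep_eq uminus_gamma.rep_eq times_gamma.rep_eq)
  qed
  then show ?thesis by (auto simp: series_inject)
qed

lemma ring_hom_Rinf_unique:
  assumes f: "ring_hom f" and g: "ring_hom g"
    and t: "\<And>j. f (tvar j) = g (tvar j)" and z: "\<And>j. f (zvar j) = g (zvar j)"
    and Q: "\<And>r. f (Q r) = g (Q r)"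
  shows "f = g"
proof
  fix p :: Rinf
  note simps = ring_homD[OF f] ring_homD[OF g] ring_homD[OF ring_hom_const]
  have c: "f (const c) = g (const c)" for c
    by (induction c rule: gamma_induct) (simp_all add: simps Q[unfolded Q_def])
  have v: "f (case_var tvar zvar v) = g (case_var tvar zvar v)" for v
    by (cases v) (simp_all add: t z)
  have s: "f (Poly_Mapping.single m c) = g (Poly_Mapping.single m c)" for m c
    unfolding single_eq_eval_var eval_var_def
    by (simp add: simps c v ring_hom_prod[OF f] ring_hom_prod[OF g]
        ring_hom_power[OF f] ring_hom_power[OF g])
  show "f p = g p"
    by (subst (1 2) poly_mapping_sum_single[of p])
       (simp add: ring_hom_sum[OF f] ring_hom_sum[OF g] s)
qed

lemma ring_automorphism_involution:
  assumes "ring_hom f" "\<And>j. f (f (tvar j)) = tvar j" "\<And>j. f (f (zvar j)) = zvar j"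
    "\<And>r. f (f (Q r)) = Q r"
  shows "ring_automorphism f"
proof -
  have "f \<circ> f = id"
    by (rule ring_hom_Rinf_unique) (use assms in \<open>auto simp: ring_hom_def\<close>)
  then show ?thesis using assms(1) o_bij by (auto simp: ring_automorphism_def)
qed

text \<open>On $\Gamma$, the automorphism $s_0^z$ is the substitution of $z_1, x_1, x_2, \ldots$ for
  $x_1, x_2, x_3, \ldots$; the coefficient of $z_1^j$ in the result is \<open>slice j\<close>.\<close>

lift_definition exp_cons :: "nat \<Rightarrow> (nat \<Rightarrow>\<^sub>0 nat) \<Rightarrow> (nat \<Rightarrow>\<^sub>0 nat)" is case_nat
proof -
  fix j and f :: "nat \<Rightarrow> nat"
  assume "finite {x. f x \<noteq> 0}"
  moreover have "{x. case_nat j f x \<noteq> 0} \<subseteq> insert 0 (Suc ` {x. f x \<noteq> 0})"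
  proof
    fix x assume "x \<in> {x. case_nat j f x \<noteq> 0}"
    then show "x \<in> insert 0 (Suc ` {x. f x \<noteq> 0})" by (cases x) simp_all
  qed
  ultimately show "finite {x. case_nat j f x \<noteq> 0}"
    by (meson finite.insertI finite_imageI finite_subset)
qed

lift_definition exp_tl :: "(nat \<Rightarrow>\<^sub>0 nat) \<Rightarrow> (nat \<Rightarrow>\<^sub>0 nat)" is "\<lambda>f i. f (Suc i)"
proof -
  fix f :: "nat \<Rightarrow> nat"
  assume "finite {x. f x \<noteq> 0}"
  then show "finite {x. f (Suc x) \<noteq> 0}"
    using finite_vimageI[of "{x. f x \<noteq> 0}" Suc] by (simp add: vimage_def)
qed

lemma exp_cons_tl [simp]: "exp_cons (lookup m 0) (exp_tl m) = m"
  by transfer (auto split: nat.splits)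

lemma exp_tl_cons [simp]: "exp_tl (exp_cons j m) = m"
  by transfer auto

lemma lookup_exp_cons_0 [simp]: "lookup (exp_cons j m) 0 = j"
  by transfer auto

lemma exp_cons_add: "exp_cons i a + exp_cons j b = exp_cons (i + j) (a + b)"
  by transfer (auto split: nat.splits)

lemma exp_tl_add: "exp_tl (a + b) = exp_tl a + exp_tl b"
  by transfer auto

lemma lookup_exp_cons_Suc [simp]: "lookup (exp_cons j m) (Suc i) = lookup m i"
  by transfer auto

lemma keys_exp_cons: "keys (exp_cons j m) = (if j = 0 then {} else {0}) \<union> Suc ` keys m"
proof -
  have "i \<in> keys (exp_cons j m) \<longleftrightarrow> i \<in> (if j = 0 then {} else {0}) \<union> Suc ` keys m" for i
    by (cases i) (auto simp: in_keys_iff)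
  then show ?thesis by blast
qed

lemma tdeg_exp_cons: "tdeg (exp_cons j m) = j + tdeg m"
  unfolding tdeg_def keys_exp_cons by (simp add: sum.reindex sum.union_disjoint)

lemma card_keys_exp_cons: "card (keys (exp_cons j m)) = (if j = 0 then 0 else 1) + card (keys m)"
  by (simp add: keys_exp_cons card_image)

lift_definition slice :: "nat \<Rightarrow> xseries \<Rightarrow> xseries" is "\<lambda>j f m. f (exp_cons j m)" .

lemma slice_add: "slice j (f + g) = slice j f + slice j g"
  by (rule xseries_eqI) (simp add: slice.rep_eq plus_xseries.rep_eq)

lemma slice_uminus: "slice j (- f) = - slice j f"
  by (rule xseries_eqI) (simp add: slice.rep_eq uminus_xseries.rep_eq)

lemma slice_1: "slice j 1 = (if j = 0 then 1 else 0)"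
proof -
  have "exp_cons j m = 0 \<longleftrightarrow> j = 0 \<and> m = 0" for m
    using tdeg_eq_0_iff[of "exp_cons j m"] by (simp only: tdeg_exp_cons add_is_0 tdeg_eq_0_iff)
  then show ?thesis
    by (auto intro!: xseries_eqI simp: slice.rep_eq one_xseries.rep_eq zero_xseries.rep_eq)
qed

lemma slice_mult: "slice j (f * g) = (\<Sum>i\<le>j. slice i f * slice (j - i) g)"
proof (rule xseries_eqI)
  fix m
  have "coeff (slice j (f * g)) m = (\<Sum>(a, b)\<in>splits (exp_cons j m). coeff f a * coeff g b)"
    by (simp add: slice.rep_eq times_xseries.rep_eq)
  also have "\<dots> = (\<Sum>(i, a, b)\<in>{..j} \<times> splits m. coeff f (exp_cons i a) * coeff g (exp_cons (j - i) b))"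
  proof (rule sum.reindex_bij_witness
      [of _ "\<lambda>(i, a, b). (exp_cons i a, exp_cons (j - i) b)"
            "\<lambda>(a, b). (lookup a 0, exp_tl a, exp_tl b)"])
    fix p assume p: "p \<in> splits (exp_cons j m)"
    obtain a b where [simp]: "p = (a, b)" by fastforce
    have ab: "a + b = exp_cons j m" using p by (simp add: splits_def)
    have "lookup a 0 + lookup b 0 = j"
      by (simp only: ab lookup_exp_cons_0 flip: lookup_add)
    then have j: "lookup a 0 \<le> j" "j - lookup a 0 = lookup b 0" by simp_all
    have tl: "exp_tl a + exp_tl b = m"
      by (simp only: ab exp_tl_cons flip: exp_tl_add)
    show "(\<lambda>(i, a, b). (exp_cons i a, exp_cons (j - i) b))
        ((\<lambda>(a, b). (lookup a 0, exp_tl a, exp_tl b)) p) = p"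
      by (simp add: j(2))
    show "(\<lambda>(a, b). (lookup a 0, exp_tl a, exp_tl b)) p \<in> {..j} \<times> splits m"
      by (simp add: j(1) tl splits_def)
    show "(\<lambda>(i, a, b). coeff f (exp_cons i a) * coeff g (exp_cons (j - i) b))
        ((\<lambda>(a, b). (lookup a 0, exp_tl a, exp_tl b)) p) = (\<lambda>(a, b). coeff f a * coeff g b) p"
      by (simp add: j(2))
  qed (auto simp: splits_def exp_cons_add)
  also have "\<dots> = coeff (\<Sum>i\<le>j. slice i f * slice (j - i) g) m"
    by (simp add: coeff_sum times_xseries.rep_eq slice.rep_eq sum.cartesian_product case_prod_unfold)
  finally show "coeff (slice j (f * g)) m = coeff (\<Sum>i\<le>j. slice i f * slice (j - i) g) m" .
qed

lemma slice_Qx: "slice j (Qx r) = (if j = 0 then Qx r else if j \<le> r then 2 * Qx (r - j) else 0)"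
  by (rule xseries_eqI)
     (auto simp: slice.rep_eq coeff_Qx tdeg_exp_cons card_keys_exp_cons
       coeff_two_times zero_xseries.rep_eq)

lemma series_sum: "series (\<Sum>i\<in>A. f i) = (\<Sum>i\<in>A. series (f i))"
  by (induction A rule: infinite_finite_induct) (simp_all add: zero_gamma.rep_eq plus_gamma.rep_eq)

lemma lookup_mult_nat:
  fixes p q :: "nat \<Rightarrow>\<^sub>0 'a::comm_ring_1"
  shows "lookup (p * q) n = (\<Sum>i\<le>n. lookup p i * lookup q (n - i))"
proof -
  have 1: "lookup (Poly_Mapping.single a c * q) n = (if a \<le> n then c * lookup q (n - a) else 0)" for a c
  proof -
    have "Poly_Mapping.single a c * q = (\<Sum>b\<in>keys q. Poly_Mapping.single (a + b) (c * lookup q b))"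
      by (subst poly_mapping_sum_single[of q]) (simp add: sum_distrib_left mult_single)
    then have "lookup (Poly_Mapping.single a c * q) n
        = (\<Sum>b\<in>keys q. if a + b = n then c * lookup q b else 0)"
      by (simp add: lookup_sum lookup_single when_def)
    also have "\<dots> = (\<Sum>b\<in>keys q. if b = n - a then if a \<le> n then c * lookup q b else 0 else 0)"
      by (rule sum.cong) auto
    finally show ?thesis by (simp add: in_keys_iff)
  qed
  have "lookup (p * q) n = (\<Sum>a\<in>keys p. lookup (Poly_Mapping.single a (lookup p a) * q) n)"
    by (subst poly_mapping_sum_single[of p]) (simp add: sum_distrib_right lookup_sum)
  also have "\<dots> = (\<Sum>a\<in>keys p. if a \<le> n then lookup p a * lookup q (n - a) else 0)"
    by (simp add: 1)
  also have "\<dots> = (\<Sum>a\<in>{..n} \<union> keys p. if a \<le> n then lookup p a * lookup q (n - a) else 0)"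
    by (rule sum.mono_neutral_left) (auto simp: in_keys_iff)
  also have "\<dots> = (\<Sum>a\<le>n. lookup p a * lookup q (n - a))"
    by (rule sum.mono_neutral_cong_right) auto
  finally show ?thesis .
qed

lemma series_two_times: "series (2 * g) = 2 * series g"
  unfolding mult_2 plus_gamma.rep_eq by (rule refl)

lemma slice_gamma:
  "\<exists>p :: nat \<Rightarrow>\<^sub>0 gamma. \<forall>j. slice j (series g) = series (lookup p j)"
proof (induction g rule: gamma_induct)
  case one
  show ?case
    by (rule exI[of _ 1])
       (auto simp: slice_1 lookup_one when_def one_gamma.rep_eq zero_gamma.rep_eq)
next
  case (Q r)
  show ?case
  proof (rule exI, rule allI)
    fix j
    show "slice j (series (Qgamma r)) = series (lookup
        (\<Sum>i\<le>r. Poly_Mapping.single i (if i = 0 then Qgamma r else 2 * Qgamma (r - i))) j)"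
      by (auto simp: slice_Qx Qgamma.rep_eq lookup_sum lookup_single when_def zero_gamma.rep_eq
          series_two_times)
  qed
next
  case (add a b)
  then obtain p q where "\<forall>j. slice j (series a) = series (lookup p j)"
    "\<forall>j. slice j (series b) = series (lookup q j)" by auto
  then show ?case
    by (intro exI[of _ "p + q"]) (simp add: plus_gamma.rep_eq slice_add lookup_add)
next
  case (uminus a)
  then obtain p where "\<forall>j. slice j (series a) = series (lookup p j)" by auto
  then show ?case
    by (intro exI[of _ "- p"]) (simp add: uminus_gamma.rep_eq slice_uminus)
next
  case (mult a b)
  then obtain p q where "\<forall>j. slice j (series a) = series (lookup p j)"
    "\<forall>j. slice j (series b) = series (lookup q j)" by auto
  then show ?case
    by (intro exI[of _ "p * q"])
       (simp add: times_gamma.rep_eq slice_mult lookup_mult_nat series_sum)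
qed

definition slices :: "gamma \<Rightarrow> (nat \<Rightarrow>\<^sub>0 gamma)"
  where "slices g = (SOME p. \<forall>j. slice j (series g) = series (lookup p j))"

lemma series_lookup_slices: "series (lookup (slices g) j) = slice j (series g)"
  unfolding slices_def by (rule someI_ex[OF slice_gamma[of g], THEN spec, symmetric])

lemma slices_eqI:
  assumes "\<And>j. slice j (series g) = series (lookup p j)"
  shows "slices g = p"
proof (rule poly_mapping_eqI)
  fix j
  have "series (lookup (slices g) j) = series (lookup p j)"
    unfolding series_lookup_slices by (rule assms)
  then show "lookup (slices g) j = lookup p j" by (simp only: series_inject)
qed

lemma ring_hom_slices: "ring_hom slices"
  unfolding ring_hom_def
proof (intro conjI allI; rule slices_eqI)
  show "slice j (series 1) = series (lookup 1 j)" for j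
    by (simp add: one_gamma.rep_eq zero_gamma.rep_eq slice_1 lookup_one when_def)
  show "slice j (series (a + b)) = series (lookup (slices a + slices b) j)" for a b j
    by (simp add: plus_gamma.rep_eq slice_add lookup_add series_lookup_slices)
  show "slice j (series (a * b)) = series (lookup (slices a * slices b) j)" for a b j
    by (simp add: times_gamma.rep_eq slice_mult lookup_mult_nat series_sum series_lookup_slices)
qed

lemma slices_Qgamma:
  "slices (Qgamma r) =
    (\<Sum>i\<le>r. Poly_Mapping.single i (if i = 0 then Qgamma r else 2 * Qgamma (r - i)))"
  by (rule slices_eqI)
     (auto simp: slice_Qx Qgamma.rep_eq lookup_sum lookup_single when_def zero_gamma.rep_eq
       series_two_times)

definition s0_gamma :: "gamma \<Rightarrow> Rinf"
  where "s0_gamma g = eval_hom const (\<lambda>j. zvar 0 ^ j) (slices g)"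

lemma ring_hom_s0_gamma: "ring_hom s0_gamma"
proof -
  have "ring_hom (eval_hom const (\<lambda>j. zvar 0 ^ j))"
    by (rule ring_hom_eval_hom[OF ring_hom_const]) (simp_all add: power_add)
  then show ?thesis
    using ring_hom_slices by (simp add: ring_hom_def s0_gamma_def)
qed

lemma s0_gamma_Qgamma: "s0_gamma (Qgamma r) = fps_nth (cayley (zvar 0) * Qgf) r"
  unfolding s0_gamma_def slices_Qgamma eval_hom_sum[OF ring_hom_const]
    eval_hom_single[OF ring_hom_const] fps_mult_nth
  by (rule sum.cong)
     (auto simp: cayley_nth Qgf_def Q_def ring_hom_2[OF ring_hom_const] ring_homD[OF ring_hom_const] algebra_simps)

lemma ex_is_sz: "\<exists>\<phi>. is_sz i \<phi>"
proof (cases "i = 0")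
  case True
  define \<phi> where "\<phi> = subst_hom s0_gamma (\<lambda>v. case v of T j \<Rightarrow> tvar j | Z j \<Rightarrow> if j = 0 then - zvar 0 else zvar j)"
  have hom: "ring_hom \<phi>"
    unfolding \<phi>_def by (rule ring_hom_subst_hom[OF ring_hom_s0_gamma])
  have t: "\<phi> (tvar j) = tvar j" and z: "\<phi> (zvar j) = (if j = 0 then - zvar 0 else zvar j)" for j
    by (simp_all add: \<phi>_def subst_hom_tvar subst_hom_zvar ring_hom_s0_gamma)
  have Q: "\<phi> (Q r) = fps_nth (cayley (zvar 0) * Qgf) r" for r
    by (simp add: \<phi>_def Q_def subst_hom_const ring_hom_s0_gamma s0_gamma_Qgamma)
  have fr: "\<phi> (fps_nth (cayley (zvar 0)) n) = fps_nth (cayley (- zvar 0)) n" for n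
    by (simp add: cayley_nth ring_homD[OF hom] ring_hom_power[OF hom] ring_hom_2[OF hom] z)
  have "fps_nth Qgf n = Q n" for n by (simp add: Qgf_def)
  then have Qn: "\<phi> (fps_nth Qgf n) = fps_nth (cayley (zvar 0) * Qgf) n" for n by (simp only: Q)
  have "\<phi> (\<phi> (Q r)) = Q r" for r
  proof -
    have "\<phi> (\<phi> (Q r)) = fps_nth (cayley (- zvar 0) * (cayley (zvar 0) * Qgf)) r"
      unfolding Q fps_mult_nth[of "cayley (zvar 0)" Qgf r] fps_mult_nth[of "cayley (- zvar 0)" _ r]
      by (simp only: ring_hom_sum[OF hom] ring_hom_mult[OF hom] fr Qn)
    also have "cayley (- zvar 0) * (cayley (zvar 0) * Qgf) = Qgf"
      using cayley_uminus[of "zvar 0"] by (metis mult.assoc mult.commute mult_1)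
    finally show ?thesis by (simp add: Qgf_def)
  qed
  then have "ring_automorphism \<phi>"
    by (intro ring_automorphism_involution hom) (simp_all add: t z ring_homD[OF hom])
  then have "is_sz i \<phi>"
    using True by (simp add: is_sz_def t z Q fps_nth_inverse)
  then show ?thesis by blast
next
  case False
  define \<tau> where "\<tau> j = (if j = i - 1 then i else if j = i then i - 1 else j)" for j
  define \<phi> where "\<phi> = subst_hom const (\<lambda>v. case v of T j \<Rightarrow> tvar j | Z j \<Rightarrow> zvar (\<tau> j))"
  have hom: "ring_hom \<phi>"
    unfolding \<phi>_def by (rule ring_hom_subst_hom[OF ring_hom_const])
  have t: "\<phi> (tvar j) = tvar j" and z: "\<phi> (zvar j) = zvar (\<tau> j)" for j
    by (simp_all add: \<phi>_def subst_hom_tvar subst_hom_zvar ring_hom_const)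
  have Q: "\<phi> (Q r) = Q r" for r
    by (simp add: \<phi>_def Q_def subst_hom_const ring_hom_const)
  have "ring_automorphism \<phi>"
    by (intro ring_automorphism_involution hom) (auto simp: t z Q \<tau>_def)
  then have "is_sz i \<phi>"
    using False by (simp add: is_sz_def t z Q) (auto simp: \<tau>_def)
  then show ?thesis by blast
qed

lemma is_sz_unique:
  assumes "is_sz i \<phi>" "is_sz i \<psi>"
  shows "\<phi> = \<psi>"
proof (rule ring_hom_Rinf_unique)
  show "\<phi> (Q r) = \<psi> (Q r)" for r
  proof (cases "i = 0")
    case True
    then have "Abs_fps (\<lambda>r. \<phi> (Q r)) = Abs_fps (\<lambda>r. \<psi> (Q r))"
      using assms by (simp add: is_sz_def)
    then show ?thesis by (simp add: fps_eq_iff)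
  qed (use assms in \<open>simp add: is_sz_def\<close>)
  show "\<phi> (zvar j) = \<psi> (zvar j)" for j
  proof (cases "i = 0")
    case True
    then show ?thesis using assms by (cases "j = 0") (simp_all add: is_sz_def)
  next
    case False
    then show ?thesis
      using assms by (cases "j = i - 1"; cases "j = i") (simp_all add: is_sz_def)
  qed
qed (use assms in \<open>auto simp: is_sz_def ring_automorphism_def\<close>)

lemma ex1_is_sz: "\<exists>!\<phi>. is_sz i \<phi>"
  using ex_is_sz is_sz_unique by blast

lemma is_sz_sz: "is_sz i (sz i)"
  unfolding sz_def by (rule theI'[OF ex1_is_sz])

end

theory Submission
  imports "HOL-Computational_Algebra.Polynomial" Defs
begin

text \<open>
  Write $A=\mathbb Z[t][\vartheta_1,\vartheta_2,\ldots]$ and let $\Theta(u)$ be the generating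
  series of the $\vartheta_r={}_k\vartheta_r^{(0)}$. That \<open>A\<close> is invariant is visible on $\Theta(u)$:
  the factor that $s_0^z$ puts on $Q(u)$ turns $1-z_1u$ back into $1+z_1u$ (\<open>sz_theta\<close>).

  For the converse, let \<open>f\<close> be invariant. Since $s_i^z$ with \<open>i > k\<close> moves a variable that occurs
  in \<open>f\<close> to one that does not, \<open>f\<close> involves only $z_1,\ldots,z_k$ (\<open>Rinv_subset_Rfin\<close>). Now
  $Q(u)=\Theta(u)\prod_{i\le k}(1+z_iu)^{-1}$, so \<open>f\<close> lies in $A[z_1,\ldots,z_k]$; with the
  $\vartheta_r$ instead of the $Q_r$ as generators, the $s_i^z$ with \<open>i < k\<close> fix \<open>A\<close> and act by signed
  permutations of the $z_i$. These variables are not independent over \<open>A\<close>: because of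
  $Q(u)Q(-u)=1$ they satisfy $\prod_{i\le k}(1-z_i^2u^2)=\Theta(u)\Theta(-u)$.

  The variables are then removed one at a time (\<open>theta_tower_descent\<close>). Let \<open>f\<close> lie in $B[z_j]$, where
  $B=A[z_{j+1},\ldots,z_k]$. The displayed relation shows that the monic polynomial
  $\prod_{i\le j}(X^2-z_i^2)$ has its coefficients in \<open>B\<close>, and $z_j$ is a root of it. So $f=p(z_j)$
  with \<open>p\<close> over \<open>B\<close> of degree less than \<open>2j\<close>. All signed permutations of $z_1,\ldots,z_j$ fix \<open>f\<close> and
  \<open>p\<close>, whence $p(\pm z_i)=f$ for \<open>i \<le> j\<close>. Thus \<open>p - f\<close> has \<open>2j\<close> roots whose differences are not
  zero divisors and must vanish: \<open>f\<close> is the constant term of \<open>p\<close>, an element of \<open>B\<close>. After \<open>k\<close> such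
  steps \<open>f\<close> lies in \<open>A\<close>. No denominators arise, so the argument works over the integers.
\<close>

section \<open>Subrings, homomorphisms and power series\<close>

lemma subring_sum:
  assumes "is_subring A" "\<And>i. i \<in> I \<Longrightarrow> f i \<in> A"
  shows "sum f I \<in> A"
  using assms(2)
  by (induction I rule: infinite_finite_induct) (simp_all add: is_subringD[OF assms(1)])

lemma subring_prod:
  assumes "is_subring A" "\<And>i. i \<in> I \<Longrightarrow> f i \<in> A"
  shows "prod f I \<in> A"
  using assms(2)
  by (induction I rule: infinite_finite_induct) (simp_all add: is_subringD[OF assms(1)])

lemma subring_power:
  assumes "is_subring A" "a \<in> A"
  shows "a ^ n \<in> A"
  by (induction n) (simp_all add: is_subringD[OF assms(1)] assms(2))

lemma subring_hull_subset: "S \<subseteq> A \<Longrightarrow> is_subring A \<Longrightarrow> is_subring hull S \<subseteq> A"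
  by (rule hull_minimal)

lemma subring_vimage:
  assumes "ring_hom \<phi>" "is_subring A"
  shows "is_subring {a. \<phi> a \<in> A}"
  unfolding is_subring_def by (simp add: ring_homD[OF assms(1)] is_subringD[OF assms(2)])

lemma subring_fixed:
  assumes "ring_hom \<phi>"
  shows "is_subring {a. \<phi> a = a}"
  unfolding is_subring_def by (simp add: ring_homD[OF assms])

lemma subring_fps:
  assumes "is_subring A"
  shows "is_subring {F. \<forall>n. fps_nth F n \<in> A}"
  unfolding is_subring_def
  by (auto simp: fps_one_nth fps_mult_nth is_subringD[OF assms] intro!: subring_sum[OF assms])

lemma geometric_nth_in_subring:
  "is_subring A \<Longrightarrow> a \<in> A \<Longrightarrow> fps_nth (geometric a) n \<in> A"
  by (simp add: geometric_def subring_power)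

definition fps_map :: "('a::comm_ring_1 \<Rightarrow> 'b::comm_ring_1) \<Rightarrow> 'a fps \<Rightarrow> 'b fps"
  where "fps_map \<phi> F = Abs_fps (\<lambda>n. \<phi> (fps_nth F n))"

lemma fps_map_nth [simp]: "fps_nth (fps_map \<phi> F) n = \<phi> (fps_nth F n)"
  by (simp add: fps_map_def)

lemma ring_hom_fps_map:
  assumes "ring_hom \<phi>"
  shows "ring_hom (fps_map \<phi>)"
  unfolding ring_hom_def
  by (auto intro!: fps_ext simp: ring_homD[OF assms] fps_mult_nth ring_hom_sum[OF assms])

lemma fps_map_linear:
  assumes "ring_hom \<phi>"
  shows "fps_map \<phi> (1 + fps_const a * fps_X) = 1 + fps_const (\<phi> a) * fps_X"
  by (rule fps_ext) (simp add: ring_homD[OF assms] fps_X_def)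

text \<open>The substitution \<open>u \<mapsto> - u\<close>.\<close>

definition fps_neg_var :: "'a::comm_ring_1 fps \<Rightarrow> 'a fps"
  where "fps_neg_var F = Abs_fps (\<lambda>n. (- 1) ^ n * fps_nth F n)"

lemma fps_neg_var_nth [simp]: "fps_nth (fps_neg_var F) n = (- 1) ^ n * fps_nth F n"
  by (simp add: fps_neg_var_def)

lemma ring_hom_fps_neg_var: "ring_hom (fps_neg_var :: 'a::comm_ring_1 fps \<Rightarrow> _)"
  unfolding ring_hom_def
proof (intro conjI allI)
  show "fps_neg_var (1 :: 'a fps) = 1"
    by (rule fps_ext) simp
  fix F G :: "'a fps"
  show "fps_neg_var (F + G) = fps_neg_var F + fps_neg_var G"
    by (rule fps_ext) (simp add: algebra_simps)
  show "fps_neg_var (F * G) = fps_neg_var F * fps_neg_var G"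
  proof (rule fps_ext)
    fix n
    have "(- 1) ^ n * (fps_nth F i * fps_nth G (n - i)) =
        (- 1) ^ i * fps_nth F i * ((- 1) ^ (n - i) * fps_nth G (n - i))" if "i \<le> n" for i
      using that by (simp add: algebra_simps flip: power_add)
    then show "fps_nth (fps_neg_var (F * G)) n = fps_nth (fps_neg_var F * fps_neg_var G) n"
      by (auto simp: fps_mult_nth sum_distrib_left intro!: sum.cong)
  qed
qed

lemma fps_neg_var_linear:
  "fps_neg_var (1 + fps_const a * fps_X) = 1 + fps_const (- a) * fps_X"
  by (rule fps_ext) (simp add: fps_X_def)

lemma fps_neg_var_cayley: "fps_neg_var (cayley a) = cayley (- a)"
  by (rule fps_ext) (simp add: cayley_nth power_minus[of a] mult.left_commute)

lemma fps_map_neg_var: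
  assumes "ring_hom \<phi>"
  shows "fps_map \<phi> (fps_neg_var F) = fps_neg_var (fps_map \<phi> F)"
  by (rule fps_ext) (simp add: ring_homD[OF assms] ring_hom_power[OF assms])

lemma fps_nth_prod_0: "fps_nth (prod f I) 0 = (\<Prod>i\<in>I. fps_nth (f i) 0)"
  by (induction I rule: infinite_finite_induct) simp_all

lemma fps_mult_nth_eq_0:
  fixes F G :: "'a::comm_ring_1 fps"
  assumes "\<And>n. n > a \<Longrightarrow> fps_nth F n = 0" "\<And>n. n > b \<Longrightarrow> fps_nth G n = 0" "n > a + b"
  shows "fps_nth (F * G) n = 0"
  unfolding fps_mult_nth
proof (rule sum.neutral, rule ballI)
  fix i assume "i \<in> {0..n}"
  then have "i > a \<or> n - i > b" using assms(3) by auto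
  then show "fps_nth F i * fps_nth G (n - i) = 0" using assms(1,2) by auto
qed

section \<open>The relation $Q(u)Q(-u)=1$\<close>

text \<open>A coefficient of a product depends only on the coefficients at divisors of the monomial, and
  up to monomials in the first \<open>n\<close> variables \<open>Qx r\<close> agrees with the partial product
  \<open>partialQ r n\<close>. So the relation is inherited from the factors.\<close>

lemma Qx_neg_var: "Abs_fps Qx * fps_neg_var (Abs_fps Qx) = 1"
proof (rule fps_ext, rule xseries_eqI)
  fix r and m :: "nat \<Rightarrow>\<^sub>0 nat"
  obtain n where n: "keys m \<subseteq> {..<n}"
    using finite_nat_set_iff_bounded[of "keys m"] by auto
  define P where "P = (\<Prod>i<n. cayley (xvar i))"
  have P_nth: "fps_nth P r = partialQ r n" for r
    by (simp add: P_def partialQ_def)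
  have agree: "coeff (partialQ s n) a = coeff (Qx s) a" if "keys a \<subseteq> {..<n}" for s a
    using that by (simp add: coeff_partialQ coeff_Qx)
  have keys_split: "keys a \<subseteq> {..<n}" "keys b \<subseteq> {..<n}" if "(a, b) \<in> splits m" for a b
  proof -
    have "keys a \<subseteq> keys m" "keys b \<subseteq> keys m"
      using that by (auto simp: splits_def in_keys_iff lookup_add)
    with n show "keys a \<subseteq> {..<n}" "keys b \<subseteq> {..<n}" by auto
  qed
  have sgn: "coeff ((- 1) ^ s * f) a = (- 1) ^ s * coeff f a" for s f a
    by (cases "even s") (simp_all add: uminus_xseries.rep_eq)
  have product: "coeff (f * ((- 1) ^ s * g)) m = (- 1) ^ s * (\<Sum>(a, b)\<in>splits m. coeff f a * coeff g b)"
    for f g s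
    unfolding mult.left_commute[of f] sgn by (simp only: times_xseries.rep_eq)
  have "coeff (fps_nth (Abs_fps Qx * fps_neg_var (Abs_fps Qx)) r) m
      = coeff (fps_nth (P * fps_neg_var P) r) m"
    unfolding fps_mult_nth coeff_sum fps_neg_var_nth fps_nth_Abs_fps P_nth product
    by (rule sum.cong[OF refl], rule arg_cong[where f = "(*) _"], rule sum.cong[OF refl])
       (clarify, simp only: agree keys_split)
  also have "P * fps_neg_var P = 1"
    by (simp add: P_def ring_hom_prod[OF ring_hom_fps_neg_var] fps_neg_var_cayley
        cayley_uminus flip: prod.distrib)
  finally show "coeff (fps_nth (Abs_fps Qx * fps_neg_var (Abs_fps Qx)) r) m = coeff (fps_nth 1 r) m" .
qed

lemma ring_hom_series: "ring_hom series"
  by (simp add: ring_hom_def one_gamma.rep_eq plus_gamma.rep_eq times_gamma.rep_eq)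

lemma Qgf_neg_var: "Qgf * fps_neg_var Qgf = 1"
proof -
  let ?G = "Abs_fps Qgamma"
  have "fps_map series ?G = Abs_fps Qx"
    by (rule fps_ext) (simp add: Qgamma.rep_eq)
  then have "fps_map series (?G * fps_neg_var ?G) = fps_map series 1"
    using Qx_neg_var
    by (simp add: ring_homD[OF ring_hom_fps_map[OF ring_hom_series]] fps_map_neg_var[OF ring_hom_series])
  then have G: "?G * fps_neg_var ?G = 1"
    by (simp add: fps_eq_iff series_inject)
  have "fps_map const ?G = Qgf"
    by (rule fps_ext) (simp add: Qgf_def Q_def)
  then show ?thesis
    using arg_cong[OF G, of "fps_map const"]
    by (simp add: ring_homD[OF ring_hom_fps_map[OF ring_hom_const]] fps_map_neg_var[OF ring_hom_const])
qed

section \<open>Invariance of the theta series\<close>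

definition thetagf :: "nat \<Rightarrow> Rinf fps"
  where "thetagf k = Qgf * (\<Prod>i<k. 1 + fps_const (zvar i) * fps_X)"

lemma thetagf_nth [simp]: "fps_nth (thetagf k) r = theta k r"
  by (simp add: thetagf_def theta_def)

lemma ring_hom_sz: "ring_hom (sz i)"
  using is_sz_sz[of i] by (simp add: is_sz_def ring_automorphism_def)

lemma sz_tvar [simp]: "sz i (tvar j) = tvar j"
  using is_sz_sz[of i] by (simp add: is_sz_def)

lemma sz_0_zvar [simp]: "sz 0 (zvar j) = (if j = 0 then - zvar 0 else zvar j)"
  using is_sz_sz[of 0] by (simp add: is_sz_def)

lemma sz_Suc_zvar [simp]: "sz (Suc i) (zvar j) = zvar (if j = i then Suc i else if j = Suc i then i else j)"
  using is_sz_sz[of "Suc i"] by (simp add: is_sz_def)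

lemma sz_Suc_Q [simp]: "sz (Suc i) (Q r) = Q r"
  using is_sz_sz[of "Suc i"] by (simp add: is_sz_def)

lemma fps_map_sz_0_Qgf: "fps_map (sz 0) Qgf = cayley (zvar 0) * Qgf"
  using is_sz_sz[of 0] by (simp add: is_sz_def fps_map_def Qgf_def)

text \<open>The factor $(1+z_1u)/(1-z_1u)$ that $s_0^z$ puts on $Q(u)$ compensates the sign change in
  the factor $1+z_1u$; the other generators permute the factors.\<close>

lemma fps_map_sz_thetagf:
  assumes "i \<noteq> k"
  shows "fps_map (sz i) (thetagf k) = thetagf k"
proof -
  let ?z = "\<lambda>a. 1 + fps_const a * fps_X :: Rinf fps"
  note hom = ring_hom_fps_map[OF ring_hom_sz]
  have img: "fps_map (sz i) (thetagf k) = fps_map (sz i) Qgf * (\<Prod>l<k. ?z (sz i (zvar l)))"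
    by (simp add: thetagf_def ring_hom_mult[OF hom] ring_hom_prod[OF hom] fps_map_linear[OF ring_hom_sz])
  show ?thesis
  proof (cases i)
    case 0
    then have split: "{..<k} = insert 0 {1..<k}" using assms by auto
    have "?z (- zvar 0) * cayley (zvar 0) = ?z (zvar 0)"
    proof -
      have "?z (- zvar 0) * cayley (zvar 0)
          = ?z (zvar 0) * ((1 - fps_const (zvar 0) * fps_X) * geometric (zvar 0))"
        by (simp add: cayley_def algebra_simps flip: fps_const_neg)
      then show ?thesis by (simp only: geometric_inverse mult_1_right)
    qed
    moreover have "fps_map (sz i) (thetagf k)
        = Qgf * ((?z (- zvar 0) * cayley (zvar 0)) * (\<Prod>l\<in>{1..<k}. ?z (zvar l)))"
      unfolding img by (simp only: 0 split fps_map_sz_0_Qgf) (simp add: mult_ac del: fps_const_neg)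
    ultimately show ?thesis
      unfolding thetagf_def split by simp
  next
    case (Suc n)
    let ?\<tau> = "\<lambda>l. if l = n then Suc n else if l = Suc n then n else l"
    have "fps_map (sz i) Qgf = Qgf"
      by (rule fps_ext) (simp add: Suc Qgf_def)
    moreover have "(\<Prod>l<k. ?z (zvar (?\<tau> l))) = (\<Prod>l<k. ?z (zvar l))"
      using assms Suc by (intro prod.reindex_bij_witness[of _ ?\<tau> ?\<tau>]) (auto split: if_splits)
    ultimately show ?thesis
      unfolding img by (simp add: Suc thetagf_def)
  qed
qed

lemma sz_theta: "i \<noteq> k \<Longrightarrow> sz i (theta k r) = theta k r"
  using arg_cong[OF fps_map_sz_thetagf, of i k "\<lambda>F. fps_nth F r"] by simp

section \<open>Eliminating the variables beyond the first \<open>k\<close>\<close>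

definition Rfin :: "nat \<Rightarrow> Rinf set"
  where "Rfin n = is_subring hull (range tvar \<union> range Q \<union> zvar ` {..<n})"

lemma is_subring_Rfin: "is_subring (Rfin n)"
  unfolding Rfin_def by (rule is_subring_hull)

lemma Rfin_gens: "tvar i \<in> Rfin n" "Q r \<in> Rfin n" "i < n \<Longrightarrow> zvar i \<in> Rfin n"
  unfolding Rfin_def by (auto intro!: hull_inc)

lemma const_in_Rfin: "const c \<in> Rfin n"
  by (induction c rule: gamma_induct)
     (simp_all add: ring_homD[OF ring_hom_const] is_subringD[OF is_subring_Rfin]
       Rfin_gens(2)[unfolded Q_def])

lemma ex_Rfin: "\<exists>n. f \<in> Rfin n"
proof -
  define V where "V = {i. \<exists>m\<in>keys f. Z i \<in> keys m}"
  have "V = (\<Union>m\<in>keys f. Z -` keys m)" by (auto simp: V_def)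
  moreover have "finite (Z -` keys m)" for m :: "var \<Rightarrow>\<^sub>0 nat"
    by (rule finite_vimageI) (auto intro: injI)
  ultimately have "finite V" by simp
  then obtain n where n: "\<And>i. i \<in> V \<Longrightarrow> i < n"
    using finite_nat_set_iff_bounded by auto
  have v: "case_var tvar zvar v \<in> Rfin n" if "m \<in> keys f" "v \<in> keys m" for m v
    using that n by (cases v) (auto simp: V_def intro!: Rfin_gens)
  have "Poly_Mapping.single m (lookup f m) \<in> Rfin n" if "m \<in> keys f" for m
    unfolding single_eq_eval_var eval_var_def
    using that v
    by (auto intro!: is_subringD(6)[OF is_subring_Rfin] const_in_Rfin
        subring_prod[OF is_subring_Rfin] subring_power[OF is_subring_Rfin])
  then have "(\<Sum>m\<in>keys f. Poly_Mapping.single m (lookup f m)) \<in> Rfin n"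
    by (rule subring_sum[OF is_subring_Rfin])
  then show ?thesis by (metis poly_mapping_sum_single)
qed

text \<open>Exchange the last variable of \<open>f\<close> with one that does not occur in \<open>f\<close>, and set the latter to
  zero: the composite fixes \<open>f\<close> and kills the last variable.\<close>

lemma Rfin_descent:
  assumes f: "f \<in> Rfin (Suc n)" and inv: "sz (Suc n) f = f"
  shows "f \<in> Rfin n"
proof -
  define \<psi> where "\<psi> = subst_hom const
    (\<lambda>v. case v of T j \<Rightarrow> tvar j | Z j \<Rightarrow> if j = Suc n then 0 else zvar j)"
  have hom: "ring_hom \<psi>"
    unfolding \<psi>_def by (rule ring_hom_subst_hom[OF ring_hom_const])
  have t: "\<psi> (tvar j) = tvar j" and z: "\<psi> (zvar j) = (if j = Suc n then 0 else zvar j)"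
    and Q: "\<psi> (Q r) = Q r" for j r
    by (simp_all add: \<psi>_def subst_hom_tvar subst_hom_zvar subst_hom_const ring_hom_const Q_def)
  have hom': "ring_hom (\<lambda>a. \<psi> (sz (Suc n) a))"
    using hom ring_hom_sz[of "Suc n"] by (simp add: ring_hom_def)
  have "Rfin (Suc n) \<subseteq> {a. \<psi> a = a}"
    unfolding Rfin_def by (rule subring_hull_subset[OF _ subring_fixed[OF hom]]) (auto simp: t z Q)
  then have "\<psi> f = f" using f by auto
  moreover have "Rfin (Suc n) \<subseteq> {a. \<psi> (sz (Suc n) a) \<in> Rfin n}"
    unfolding Rfin_def[of "Suc n"]
    by (rule subring_hull_subset[OF _ subring_vimage[OF hom' is_subring_Rfin]])
       (auto simp: t z Q Rfin_gens is_subringD[OF is_subring_Rfin])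
  then have "\<psi> (sz (Suc n) f) \<in> Rfin n" using f by auto
  ultimately show ?thesis by (simp add: inv)
qed

lemma Rinv_subset_Rfin: "Rinv k \<subseteq> Rfin k"
proof
  fix f assume f: "f \<in> Rinv k"
  have "f \<in> Rfin (k + d) \<Longrightarrow> f \<in> Rfin k" for d
  proof (induction d)
    case (Suc d)
    then show ?case using Rfin_descent[of f "k + d"] f by (simp add: Rinv_def)
  qed simp
  moreover obtain n where n: "f \<in> Rfin n" using ex_Rfin by blast
  moreover have "Rfin n \<subseteq> Rfin (k + n)"
    unfolding Rfin_def by (rule hull_mono) auto
  ultimately show "f \<in> Rfin k" by blast
qed

section \<open>Adjoining some of the first \<open>k\<close> variables to the theta ring\<close>

text \<open>The ring is $\mathbb Z[t][\vartheta_1,\vartheta_2,\ldots]$ at \<open>j = k\<close> and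
  $\Gamma[t,z_1,\ldots,z_k]$ at \<open>j = 0\<close>.\<close>

definition theta_tower :: "nat \<Rightarrow> nat \<Rightarrow> Rinf set"
  where "theta_tower k j = is_subring hull (range tvar \<union> range (theta k) \<union> zvar ` {j..<k})"

lemma is_subring_theta_tower: "is_subring (theta_tower k j)"
  unfolding theta_tower_def by (rule is_subring_hull)

lemma theta_tower_gens:
  "tvar i \<in> theta_tower k j" "theta k r \<in> theta_tower k j" "j \<le> i \<Longrightarrow> i < k \<Longrightarrow> zvar i \<in> theta_tower k j"
  unfolding theta_tower_def by (auto intro!: hull_inc)

text \<open>Solving $\Theta(u)=Q(u)\prod_i(1+z_iu)$ for $Q(u)$.\<close>

lemma Q_in_theta_tower: "Q r \<in> theta_tower k 0"
proof -
  let ?z = "\<lambda>i. 1 + fps_const (zvar i) * fps_X :: Rinf fps"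
  let ?B = "{F. \<forall>n. fps_nth F n \<in> theta_tower k 0}"
  have "?z i * geometric (- zvar i) = 1" for i
    using geometric_inverse[of "- zvar i"] by (simp flip: fps_const_neg)
  then have "thetagf k * (\<Prod>i<k. geometric (- zvar i)) = Qgf"
    by (simp add: thetagf_def mult.assoc flip: prod.distrib)
  moreover have "thetagf k * (\<Prod>i<k. geometric (- zvar i)) \<in> ?B"
    by (intro is_subringD(6) subring_prod subring_fps is_subring_theta_tower)
       (auto intro!: geometric_nth_in_subring is_subringD(4) is_subring_theta_tower theta_tower_gens)
  ultimately have "Qgf \<in> ?B" by simp
  then show ?thesis by (simp add: Qgf_def)
qed

lemma Rfin_subset_theta_tower: "Rfin k \<subseteq> theta_tower k 0"
  unfolding Rfin_def
  by (rule subring_hull_subset[OF _ is_subring_theta_tower])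
     (auto intro: Q_in_theta_tower theta_tower_gens)

text \<open>$\prod_{i\le j}(1-z_i^2u^2)$\<close>

definition sqprod :: "nat \<Rightarrow> Rinf fps"
  where "sqprod j = (\<Prod>i<j. (1 + fps_const (zvar i) * fps_X) * (1 + fps_const (- zvar i) * fps_X))"

text \<open>The relation $Q(u)Q(-u)=1$ becomes $\Theta(u)\Theta(-u)=\prod_{i\le k}(1-z_i^2u^2)$, so the
  elementary symmetric polynomials in all $z_i^2$ are polynomials in the $\vartheta_r$. Dividing by
  the factors that belong to variables in \<open>theta_tower k j\<close> leaves those in the squares of the
  remaining variables.\<close>

lemma sqprod_nth_in_theta_tower:
  assumes "j \<le> k"
  shows "fps_nth (sqprod j) n \<in> theta_tower k j"
proof -
  let ?z = "\<lambda>a. 1 + fps_const a * fps_X :: Rinf fps"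
  let ?B = "{F. \<forall>n. fps_nth F n \<in> theta_tower k j}"
  have inv: "?z a * geometric (- a) = 1" for a
    using geometric_inverse[of "- a"] by (simp flip: fps_const_neg)
  have "fps_neg_var (thetagf k) = fps_neg_var Qgf * (\<Prod>i<k. ?z (- zvar i))"
    by (simp add: thetagf_def ring_hom_mult[OF ring_hom_fps_neg_var]
        ring_hom_prod[OF ring_hom_fps_neg_var] fps_neg_var_linear)
  then have "thetagf k * fps_neg_var (thetagf k)
      = (Qgf * fps_neg_var Qgf) * ((\<Prod>i<k. ?z (zvar i)) * (\<Prod>i<k. ?z (- zvar i)))"
    by (simp only: thetagf_def mult_ac)
  also have "\<dots> = sqprod k"
    by (simp only: Qgf_neg_var sqprod_def prod.distrib mult_1)
  also have "\<dots> = sqprod j * (\<Prod>i\<in>{j..<k}. ?z (zvar i) * ?z (- zvar i))"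
    unfolding sqprod_def
    by (subst prod.union_disjoint[symmetric]) (simp_all only: finite_lessThan finite_atLeastLessThan
        ivl_disj_un_one(2)[OF assms] ivl_disj_int_one)
  finally have theta: "thetagf k * fps_neg_var (thetagf k) = \<dots>" .
  have inv2: "?z a * ?z (- a) * (geometric (- a) * geometric a) = 1" for a
  proof -
    have "?z a * ?z (- a) * (geometric (- a) * geometric a)
        = (?z a * geometric (- a)) * (?z (- a) * geometric (- (- a)))"
      by (simp only: mult_ac minus_minus)
    then show ?thesis by (simp only: inv mult_1)
  qed
  have "thetagf k * fps_neg_var (thetagf k) *
      (\<Prod>i\<in>{j..<k}. geometric (- zvar i) * geometric (zvar i)) = sqprod j"
    unfolding theta mult.assoc[of "sqprod j"]
    by (simp only: prod.distrib[symmetric] inv2 prod.neutral_const mult_1_right)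
  moreover have "fps_neg_var (thetagf k) \<in> ?B"
    by (auto intro!: is_subringD(6)[OF is_subring_theta_tower] subring_power[OF is_subring_theta_tower]
        theta_tower_gens simp: is_subringD[OF is_subring_theta_tower])
  then have "thetagf k * fps_neg_var (thetagf k) *
      (\<Prod>i\<in>{j..<k}. geometric (- zvar i) * geometric (zvar i)) \<in> ?B"
    by (intro is_subringD(6) subring_prod subring_fps is_subring_theta_tower)
       (auto intro!: geometric_nth_in_subring is_subringD(4) is_subring_theta_tower theta_tower_gens)
  ultimately show ?thesis by simp
qed

section \<open>Polynomials with many roots\<close>

definition nonzerodivisor :: "'a::comm_ring_1 \<Rightarrow> bool"
  where "nonzerodivisor a \<longleftrightarrow> (\<forall>g. a * g = 0 \<longrightarrow> g = 0)"

lemma nonzerodivisor_uminus: "nonzerodivisor a \<Longrightarrow> nonzerodivisor (- a)"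
  unfolding nonzerodivisor_def by (metis mult_minus_left neg_equal_0_iff_equal)

lemma nonzerodivisor_mult: "nonzerodivisor a \<Longrightarrow> nonzerodivisor b \<Longrightarrow> nonzerodivisor (a * b)"
  unfolding nonzerodivisor_def by (metis mult.assoc)

text \<open>Over an arbitrary commutative ring a linear factor can still be split off for each root; the
  remaining points are roots of the quotient since the differences can be cancelled.\<close>

lemma poly_eq_0_if_roots:
  fixes p :: "'a::comm_ring_1 poly"
  assumes "finite I" "I \<noteq> {}" "degree p < card I" "\<And>i. i \<in> I \<Longrightarrow> poly p (y i) = 0"
    "\<And>i l. i \<in> I \<Longrightarrow> l \<in> I \<Longrightarrow> i \<noteq> l \<Longrightarrow> nonzerodivisor (y i - y l)"
  shows "p = 0"
  using assms
proof (induction I arbitrary: p rule: finite_ne_induct)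
  case (singleton i)
  then obtain c where "p = [:c:]" by (auto elim: degree_eq_zeroE)
  then show ?case using singleton by simp
next
  case (insert i I)
  define q where "q = synthetic_div p (y i)"
  have p: "p = [:- y i, 1:] * q"
    using synthetic_div_correct'[of "y i" p] insert.prems(2)[of i] by (simp add: q_def)
  have "poly q (y l) = 0" if l: "l \<in> I" for l
  proof -
    have "l \<noteq> i" using l insert.hyps by auto
    then have "nonzerodivisor (y l - y i)" using insert.prems(3)[of l i] l by simp
    moreover have "(y l - y i) * poly q (y l) = 0"
      using insert.prems(2)[of l] l by (simp add: p algebra_simps)
    ultimately show ?thesis unfolding nonzerodivisor_def by blast
  qed
  moreover have "degree q < card I"
    using insert.prems(1) insert.hyps card_gt_0_iff[of I]
    by (simp add: q_def degree_synthetic_div less_diff_conv2 Suc_le_eq)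
  ultimately have "q = 0"
    using insert.IH insert.prems(3) by simp
  then show ?case by (simp add: p)
qed

lemma lookup_single_times:
  fixes g :: Rinf
  shows "lookup (Poly_Mapping.single a 1 * g) m = (\<Sum>b\<in>keys g. if a + b = m then lookup g b else 0)"
proof -
  have "Poly_Mapping.single a 1 * g = (\<Sum>b\<in>keys g. Poly_Mapping.single (a + b) (lookup g b))"
    by (subst poly_mapping_sum_single[of g]) (simp add: sum_distrib_left mult_single)
  then show ?thesis by (simp add: lookup_sum lookup_single when_def)
qed

lemma lookup_zvar_times_add:
  "lookup (zvar i * g) (Poly_Mapping.single (Z i) 1 + m) = lookup g m"
  unfolding zvar_def lookup_single_times by (simp add: in_keys_iff)

lemma lookup_zvar_times_eq_0:
  assumes "lookup m (Z i) = 0"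
  shows "lookup (zvar i * g) m = 0"
  unfolding zvar_def lookup_single_times
  using assms by (intro sum.neutral) (auto simp: lookup_add lookup_single)

lemma nonzerodivisor_zvar: "nonzerodivisor (zvar i)"
  unfolding nonzerodivisor_def
proof (intro allI impI poly_mapping_eqI)
  fix g m assume "zvar i * g = 0"
  then show "lookup g m = lookup 0 m"
    using lookup_zvar_times_add[of i g m] by simp
qed

lemma nonzerodivisor_2: "nonzerodivisor (2 :: Rinf)"
  unfolding nonzerodivisor_def
proof (intro allI impI poly_mapping_eqI)
  fix g :: Rinf and m assume "2 * g = 0"
  then have "2 * lookup g m = 0"
    by (metis lookup_add lookup_zero mult_2)
  then have "2 * series (lookup g m) = 0"
    by (metis series_two_times zero_gamma.rep_eq)
  then have "2 * coeff (series (lookup g m)) a = 0" for a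
    by (metis coeff_two_times zero_xseries.rep_eq)
  then have "series (lookup g m) = series 0"
    by (intro xseries_eqI) (simp add: zero_gamma.rep_eq zero_xseries.rep_eq)
  then show "lookup g m = lookup 0 m" by (simp add: series_inject)
qed

text \<open>If $z_ig=\pm z_lg$, the coefficient of \<open>g\<close> at \<open>m\<close> is, up to sign, the one at
  $mz_i/z_l$, and vanishes when $z_l$ does not divide $m$; the exponent of $z_l$ decreases.\<close>

lemma nonzerodivisor_zvar_combination:
  assumes "i \<noteq> l" "\<epsilon> = 1 \<or> \<epsilon> = - 1"
  shows "nonzerodivisor (zvar i - \<epsilon> * zvar l)"
  unfolding nonzerodivisor_def
proof (intro allI impI)
  fix g assume "(zvar i - \<epsilon> * zvar l) * g = 0"
  then have eq: "zvar i * g = zvar l * g \<or> zvar i * g = - (zvar l * g)"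
    using assms(2) by (elim disjE) (simp_all add: algebra_simps eq_neg_iff_add_eq_0)
  have "lookup g m = 0" if "lookup m (Z l) = n" for m n
    using that
  proof (induction n arbitrary: m)
    case 0
    have "lookup (zvar l * g) (Poly_Mapping.single (Z i) 1 + m) = 0"
      using 0 assms(1) by (intro lookup_zvar_times_eq_0) (simp add: lookup_add lookup_single)
    then show ?case using eq lookup_zvar_times_add[of i g m] by auto
  next
    case (Suc n)
    define m' where "m' = Poly_Mapping.single (Z i) 1 + (m - Poly_Mapping.single (Z l) 1)"
    have "Poly_Mapping.single (Z i) 1 + m = Poly_Mapping.single (Z l) 1 + m'"
      using Suc.prems
      by (intro poly_mapping_eqI) (auto simp: m'_def lookup_add lookup_minus lookup_single when_def)
    moreover have "lookup g m' = 0"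
      using Suc.prems assms(1) by (intro Suc.IH) (simp add: m'_def lookup_add lookup_minus lookup_single)
    ultimately have "lookup (zvar l * g) (Poly_Mapping.single (Z i) 1 + m) = 0"
      by (simp only: lookup_zvar_times_add)
    then show ?case using eq lookup_zvar_times_add[of i g m] by auto
  qed
  then show "g = 0" by (intro poly_mapping_eqI) simp
qed

section \<open>Descending the tower\<close>

lemma subring_poly:
  assumes "is_subring B"
  shows "is_subring {p. \<forall>n. poly.coeff p n \<in> B}"
  unfolding is_subring_def
  by (auto simp: Polynomial.coeff_mult is_subringD[OF assms] poly_0_coeff_0 coeff_1
      intro!: subring_sum[OF assms])

text \<open>The hypotheses on \<open>F\<close> say that \<open>z\<close> is a root of the reversal of \<open>F\<close>, which is a monic
  polynomial of degree \<open>d\<close> over \<open>B\<close>.\<close>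

lemma poly_reduce:
  assumes B: "is_subring B" and F: "\<And>n. fps_nth F n \<in> B" "fps_nth F 0 = 1"
    and z: "\<And>n. n \<ge> d \<Longrightarrow> fps_nth (F * geometric z) n = 0" and "d > 0"
    and p: "\<And>n. poly.coeff p n \<in> B"
  obtains q where "\<And>n. poly.coeff q n \<in> B" "degree q < d" "poly q z = poly p z"
proof -
  have "\<exists>q. (\<forall>n. poly.coeff q n \<in> B) \<and> degree q < d \<and> poly q z = poly p z"
    using p
  proof (induction "degree p" arbitrary: p rule: less_induct)
    case less
    show ?case
    proof (cases "degree p < d")
      case True
      then show ?thesis using less.prems by blast
    next
      case False
      define n where "n = degree p"
      \<comment> \<open>The monic relation, multiplied by a power of the variable to have the degree of \<open>p\<close>.\<close>
      define r where "r = (\<Sum>i\<le>n. monom (fps_nth F (n - i)) i)"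
      have r: "poly.coeff r i = (if i \<le> n then fps_nth F (n - i) else 0)" for i
        by (simp add: r_def Polynomial.coeff_sum)
      have "poly r z = (\<Sum>i\<le>n. fps_nth F (n - i) * z ^ i)"
        by (simp add: r_def poly_sum poly_monom)
      also have "\<dots> = fps_nth (geometric z * F) n"
        by (simp add: fps_mult_nth geometric_def mult.commute[of "fps_nth _ _"] atMost_atLeast0)
      also have "\<dots> = 0"
        using z[of n] False by (simp add: n_def mult.commute)
      finally have rz: "poly r z = 0" .
      define p' where "p' = p - smult (lead_coeff p) r"
      have "poly.coeff p' i = 0" if "i \<ge> n" for i
        using that by (cases "i = n") (auto simp: p'_def r F(2) n_def coeff_eq_0)
      then have "degree p' < degree p"
        using False \<open>d > 0\<close> by (metis n_def degree_lessI gr_implies_not0 not_less neq0_conv)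
      moreover have "poly.coeff p' i \<in> B" for i
        by (auto simp: p'_def r intro!: is_subringD(5,6)[OF B] less.prems F is_subringD(2)[OF B])
      ultimately show ?thesis
        using less.hyps[of p'] rz by (auto simp: p'_def)
    qed
  qed
  then show ?thesis using that by blast
qed

lemma ring_hom_poly:
  assumes "ring_hom \<phi>" "\<And>n. \<phi> (poly.coeff p n) = poly.coeff p n"
  shows "\<phi> (poly p x) = poly p (\<phi> x)"
  by (simp add: poly_altdef ring_homD[OF assms(1)] ring_hom_sum[OF assms(1)]
      ring_hom_power[OF assms(1)] assms(2))

lemma theta_tower_step:
  assumes "f \<in> theta_tower k j" "j < k"
  obtains p where "\<And>n. poly.coeff p n \<in> theta_tower k (Suc j)" "f = poly p (zvar j)"
proof -
  let ?B = "{p. \<forall>n. poly.coeff p n \<in> theta_tower k (Suc j)}"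
  have B: "is_subring ?B" by (rule subring_poly[OF is_subring_theta_tower])
  have c: "[:a:] \<in> ?B" if "a \<in> theta_tower k (Suc j)" for a
    using that by (auto simp: coeff_pCons is_subringD[OF is_subring_theta_tower] split: nat.splits)
  have X: "[:0, 1:] \<in> ?B"
    by (auto simp: coeff_pCons is_subringD[OF is_subring_theta_tower] split: nat.splits)
  have "is_subring ((\<lambda>p. poly p (zvar j)) ` ?B)"
    unfolding is_subring_def
  proof (intro conjI ballI)
    show "1 \<in> (\<lambda>p. poly p (zvar j)) ` ?B"
      by (rule image_eqI[of _ _ 1]) (use is_subringD(1)[OF B] in simp_all)
  next
    fix a b assume "a \<in> (\<lambda>p. poly p (zvar j)) ` ?B" "b \<in> (\<lambda>p. poly p (zvar j)) ` ?B"
    then obtain p q where pq: "p \<in> ?B" "q \<in> ?B" "a = poly p (zvar j)" "b = poly q (zvar j)" by blast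
    show "a + b \<in> (\<lambda>p. poly p (zvar j)) ` ?B"
      using is_subringD(3)[OF B pq(1,2)] pq by (intro image_eqI[of _ _ "p + q"]) simp_all
    show "- a \<in> (\<lambda>p. poly p (zvar j)) ` ?B"
      using is_subringD(4)[OF B pq(1)] pq by (intro image_eqI[of _ _ "- p"]) simp_all
    show "a * b \<in> (\<lambda>p. poly p (zvar j)) ` ?B"
      using is_subringD(6)[OF B pq(1,2)] pq by (intro image_eqI[of _ _ "p * q"]) simp_all
  qed
  moreover have "a \<in> (\<lambda>p. poly p (zvar j)) ` ?B"
    if "a \<in> range tvar \<union> range (theta k) \<union> zvar ` {j..<k}" for a
  proof (cases "a = zvar j")
    case True
    then show ?thesis using X by (intro image_eqI[of _ _ "[:0, 1:]"]) simp_all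
  next
    case False
    then have "a \<in> theta_tower k (Suc j)"
      using that by (auto simp: theta_tower_gens) (metis theta_tower_gens(3) Suc_leI le_neq_implies_less)
    then show ?thesis using c by (intro image_eqI[of _ _ "[:a:]"]) simp_all
  qed
  ultimately have "theta_tower k j \<subseteq> (\<lambda>p. poly p (zvar j)) ` ?B"
    unfolding theta_tower_def[of k j] by (intro hull_minimal) auto
  then show ?thesis using assms(1) that by blast
qed

lemma sz_theta_tower:
  assumes "a \<in> theta_tower k (Suc j)" "i \<le> j" "j < k"
  shows "sz i a = a"
proof -
  have "theta_tower k (Suc j) \<subseteq> {a. sz i a = a}"
    unfolding theta_tower_def
    using assms(2,3) by (intro hull_minimal subring_fixed ring_hom_sz) (cases i; auto simp: sz_theta)+
  then show ?thesis using assms(1) by auto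
qed

text \<open>The automorphisms $s_0^z, \ldots, s_j^z$ fix \<open>f\<close> and \<open>theta_tower k (Suc j)\<close> and move
  \<open>zvar j\<close> to each of the \<open>2 * (j + 1)\<close> points \<open>\<plusminus> zvar i\<close>, \<open>i \<le> j\<close>. So writing \<open>f\<close> as a
  polynomial in \<open>zvar j\<close> over \<open>theta_tower k (Suc j)\<close> gives a polynomial with the value \<open>f\<close> at all
  of them; once its degree is smaller than their number, it is the constant \<open>f\<close>.\<close>

lemma theta_tower_descent:
  assumes f: "f \<in> theta_tower k j" and "j < k" and inv: "\<And>i. i \<le> j \<Longrightarrow> sz i f = f"
  shows "f \<in> theta_tower k (Suc j)"
proof -
  let ?z = "\<lambda>a. 1 + fps_const a * fps_X :: Rinf fps"
  let ?I = "{..j} \<times> (UNIV :: bool set)"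
  define y where "y = (\<lambda>(i, b). if b then zvar i else - zvar i)"
  obtain p0 where p0: "\<And>n. poly.coeff p0 n \<in> theta_tower k (Suc j)" "f = poly p0 (zvar j)"
    using theta_tower_step[OF f \<open>j < k\<close>] by blast
  have lin: "fps_nth (?z a) n = 0" if "n > 1" for a n
    using that by (simp add: fps_X_def)
  have deg: "fps_nth (sqprod i) n = 0" if "n > 2 * i" for i n
    using that
  proof (induction i arbitrary: n)
    case (Suc i)
    have two: "fps_nth (?z a * ?z b) n = 0" if "n > 2" for a b n
      by (rule fps_mult_nth_eq_0[of 1 _ 1]) (use that lin in auto)
    have "fps_nth (sqprod i * (?z (zvar i) * ?z (- zvar i))) n = 0"
      by (rule fps_mult_nth_eq_0[of "2 * i" _ 2]) (use Suc two in auto)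
    then show ?case by (simp add: sqprod_def)
  qed (simp add: sqprod_def)
  have "fps_nth (sqprod (Suc j) * geometric (zvar j)) n = 0" if "n \<ge> 2 * Suc j" for n
  proof -
    have "sqprod (Suc j) * geometric (zvar j)
        = sqprod j * ?z (zvar j) * ((1 - fps_const (zvar j) * fps_X) * geometric (zvar j))"
      by (simp add: sqprod_def mult.assoc flip: fps_const_neg)
    also have "\<dots> = sqprod j * ?z (zvar j)" by (simp only: geometric_inverse mult_1_right)
    finally show ?thesis
      using that lin deg by (auto intro!: fps_mult_nth_eq_0[of "2 * j" _ 1])
  qed
  moreover have "fps_nth (sqprod (Suc j)) 0 = 1"
    by (simp add: sqprod_def fps_nth_prod_0)
  ultimately obtain p where p: "\<And>n. poly.coeff p n \<in> theta_tower k (Suc j)" "degree p < 2 * Suc j"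
    "poly p (zvar j) = f"
    using poly_reduce[OF is_subring_theta_tower sqprod_nth_in_theta_tower,
        of "Suc j" k "2 * Suc j" "zvar j" p0]
      p0 \<open>j < k\<close> by auto
  have move: "poly p (sz i x) = f" if "poly p x = f" "i \<le> j" for i x
    using ring_hom_poly[OF ring_hom_sz, of i p x] sz_theta_tower[OF p(1) _ \<open>j < k\<close>, of i]
      inv[of i] that
    by simp
  \<comment> \<open>The exchanges carry \<open>zvar j\<close> down to \<open>zvar 0\<close>, the sign change makes it negative, and the
    exchanges carry \<open>- zvar 0\<close> back up.\<close>
  have pos: "poly p (zvar (j - d)) = f" if "d \<le> j" for d
    using that
  proof (induction d)
    case 0
    then show ?case using p(3) by simp
  next
    case (Suc d)
    define i where "i = j - Suc d"
    have "j - d = Suc i" using Suc.prems by (simp add: i_def)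
    then have "poly p (zvar (Suc i)) = f" using Suc by simp
    moreover have "Suc i \<le> j" using Suc.prems by (simp add: i_def)
    ultimately have "poly p (sz (Suc i) (zvar (Suc i))) = f" by (rule move)
    then show ?case by (simp flip: i_def)
  qed
  have neg: "poly p (- zvar i) = f" if "i \<le> j" for i
    using that
  proof (induction i)
    case 0
    then show ?case using move[of "zvar 0" 0] pos[of j] by simp
  next
    case (Suc i)
    then show ?case
      using move[of "- zvar i" "Suc i"] by (simp add: ring_homD[OF ring_hom_sz])
  qed
  have "poly p (zvar i) = f" if "i \<le> j" for i
    using pos[of "j - i"] that by simp
  then have "poly (p - [:f:]) (y i) = 0" if "i \<in> ?I" for i
    using that neg by (auto simp: y_def)
  moreover have "nonzerodivisor (y i - y l)" if "i \<noteq> l" for i l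
  proof -
    have diff: "nonzerodivisor (zvar n - zvar n')" if "n \<noteq> n'" for n n'
      using nonzerodivisor_zvar_combination[OF that, of 1] by simp
    have add: "nonzerodivisor (zvar n + zvar n')" for n n'
    proof (cases "n = n'")
      case True
      then show ?thesis
        using nonzerodivisor_mult[OF nonzerodivisor_2 nonzerodivisor_zvar[of n]] by (simp only: mult_2 True)
    next
      case False
      then show ?thesis using nonzerodivisor_zvar_combination[of n n' "- 1"] by simp
    qed
    have neg_add: "nonzerodivisor (- zvar n - zvar n')" for n n'
      using nonzerodivisor_uminus[OF add[of n n']] by simp
    obtain n b n' b' where [simp]: "i = (n, b)" "l = (n', b')" by (cases i; cases l)
    show ?thesis
      using that diff[of n n'] diff[of n' n] add[of n n'] neg_add[of n n']
      by (cases b; cases b') (simp_all add: y_def)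
  qed
  moreover have "degree (p - [:f:]) < card ?I"
    using p(2) degree_diff_le[of p "degree p" "[:f:]"] by (simp add: card_cartesian_product)
  ultimately have "p - [:f:] = 0"
    by (intro poly_eq_0_if_roots[of ?I _ y]) auto
  then have "poly.coeff p 0 = f" by simp
  then show ?thesis using p(1)[of 0] by simp
qed

section \<open>The invariant ring\<close>

lemma Rinv_subset_theta_tower: "Rinv k \<subseteq> theta_tower k k"
proof
  fix f assume f: "f \<in> Rinv k"
  have "j \<le> k \<Longrightarrow> f \<in> theta_tower k j" for j
  proof (induction j)
    case 0
    then show ?case using f Rinv_subset_Rfin Rfin_subset_theta_tower by blast
  next
    case (Suc j)
    then show ?case using f by (auto intro!: theta_tower_descent simp: Rinv_def)
  qed
  then show "f \<in> theta_tower k k" by simp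
qed

lemma is_Zt_subalgebra_hull: "is_Zt_subalgebra (is_Zt_subalgebra hull S)"
  by (rule hull_in) (auto simp: is_Zt_subalgebra_def is_subring_def)

theorem corollary6p10:
  fixes k :: nat
  shows "Rinv k = is_Zt_subalgebra hull {theta k r | r. r \<ge> 1}"
proof
  let ?H = "is_Zt_subalgebra hull {theta k r | r. r \<ge> 1}"
  have H: "is_subring ?H" "\<And>c a. c \<in> Zt \<Longrightarrow> a \<in> ?H \<Longrightarrow> c * a \<in> ?H"
    using is_Zt_subalgebra_hull by (auto simp: is_Zt_subalgebra_def)
  have "tvar i \<in> ?H" for i
    using H(2)[of "tvar i" 1] is_subringD(1)[OF H(1)] by (simp add: Zt_def hull_inc)
  moreover have "theta k r \<in> ?H" for r
  proof (cases "r = 0")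
    case True
    have "theta k 0 = 1"
      by (simp add: theta_def fps_nth_prod_0 Qgf_def Q_def)
         (metis Qgamma.rep_eq Qx_0 one_gamma.rep_eq ring_hom_1 ring_hom_const series_inject)
    then show ?thesis using True is_subringD(1)[OF H(1)] by simp
  qed (auto intro!: hull_inc)
  ultimately have "theta_tower k k \<subseteq> ?H"
    unfolding theta_tower_def by (intro hull_minimal H(1)) auto
  then show "Rinv k \<subseteq> ?H" using Rinv_subset_theta_tower by blast
next
  have sub: "is_subring (Rinv k)"
    by (auto simp: is_subring_def Rinv_def ring_homD[OF ring_hom_sz])
  have "Zt \<subseteq> Rinv k"
    unfolding Zt_def by (rule subring_hull_subset[OF _ sub]) (auto simp: Rinv_def)
  then have "is_Zt_subalgebra (Rinv k)"
    using sub by (auto simp: is_Zt_subalgebra_def is_subring_def)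
  then show "is_Zt_subalgebra hull {theta k r | r. r \<ge> 1} \<subseteq> Rinv k"
    by (intro hull_minimal) (auto simp: Rinv_def sz_theta)
qed

end
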